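(* Let $a>0$, $N\in\mathbb{N}_+$, let $m\ge 10$ be an integer, and let $\tau\ge 6$ be real. Set $k^*=\frac{\pi}{30a}$ and $\mathbb{K}_N=\{\frac{\pi}{a}|\boldsymbol{\ell}| : \boldsymbol{\ell}\in\mathbb{Z}^2,\ 1\le|\boldsymbol{\ell}|_\infty\le N\}\cup\{k^*\}$. Fix $k\in\mathbb{K}_N$ and $j\in\{1,\dots,m\}$, and let $\lambda_{j,1}=\frac12$ and $$R=\tau a,\quad \lambda_{j,2}=\frac12+\frac{\pi}{2kR}\quad\text{if } k\ne k^*;\qquad R=6a,\quad \lambda_{j,2}=-\frac32\quad\text{if } k=k^*.$$ Let $\Gamma_j$, $z_{j,\ell}$, $r_{j,\ell}$, $\Phi_k$ and $\|\cdot\|_{j,\infty}$ be as defined in the context. Let $S\in L^2(\mathbb{R}^2)$ have support compactly contained in $V_0=(-a,a)^2$, let $u(\cdot,k)$ be its radiated field at wavenumber $k$, and let $u_{j,k}=u(\cdot,k)|_{\Gamma_j}$, with $u_{j,k}\not\equiv0$. Let $0<\epsilon<1$ and let $p$, $q_1$, $q_2$ be nonnegative functions on $\Gamma_j$ (the noisy phaseless data, written $|u_{j,k}^\epsilon|$, $|v_{j,1,k}^\epsilon|$, $|v_{j,2,k}^\epsilon|$ in the paper) satisfying $$\big\|\,p-|u_{j,k}|\,\big\|_{j,\infty}\le\epsilon\|u_{j,k}\|_{j,\infty},\qquad \big\|\,q_\ell-|\hat v_{j,\ell,k}|\,\big\|_{j,\infty}\le\epsilon\|\hat v_{j,\ell,k}\|_{j,\infty},\quad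 \ell=1,2,$$ where, for $\ell=1,2$, $$c_{j,\ell,k}^\epsilon=\frac{\|p\|_{j,\infty}}{\|\Phi_k(\cdot,z_{j,\ell})\|_{j,\infty}},\qquad \hat v_{j,\ell,k}=u_{j,k}-c_{j,\ell,k}^\epsilon\,\Phi_k(\cdot,z_{j,\ell})\ \text{ on }\Gamma_j.$$ Let $u_{j,k}^\epsilon$ be the complex-valued function on $\Gamma_j$ (the recovered field) whose real and imaginary parts solve, pointwise on $\Gamma_j$, the linear system $$Y_0(kr_{j,\ell})\,\mathrm{Re}(u_{j,k}^\epsilon)-J_0(kr_{j,\ell})\,\mathrm{Im}(u_{j,k}^\epsilon)=f_{j,\ell,k}^\epsilon,\qquad \ell=1,2,$$ where $$f_{j,\ell,k}^\epsilon=\frac{2}{c_{j,\ell,k}^\epsilon}\left(q_\ell^2-p^2\right)-\frac{c_{j,\ell,k}^\epsilon}{8}\left|H_0^{(1)}(kr_{j,\ell})\right|^2,\qquad \ell=1,2.$$ Then $$\|u_{j,k}^\epsilon-u_{j,k}\|_{j,\infty}\le\epsilon\,C_\epsilon\,\|u_{j,k}\|_{j,\infty},\qquad C_\epsilon=\frac{2.5(2+\epsilon)^2(3+\epsilon)+15}{1-\epsilon}.$$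
   Context: For $\boldsymbol{\ell}=(\ell_1,\ell_2)\in\mathbb{Z}^2$, $|\boldsymbol{\ell}|$ is the Euclidean norm and $|\boldsymbol{\ell}|_\infty=\max(|\ell_1|,|\ell_2|)$. $J_0,Y_0$ are the Bessel functions of the first and second kind of order $0$, and $H^{(1)}_0=J_0+\mathrm{i}Y_0$ is the Hankel function of the first kind of order $0$. Put $\vartheta_\mu=\mu\pi/m$ for $\mu\in\mathbb{R}$. For $j=1,\dots,m$ and $\ell=1,2$: $$\Gamma_j=\{R(\cos\theta,\sin\theta):\ \vartheta_{2j-2}\le\theta\le\vartheta_{2j}\}\subset\mathbb{R}^2,\qquad z_{j,\ell}=\lambda_{j,\ell}R(\cos\vartheta_{2j-1},\sin\vartheta_{2j-1}),$$ and $r_{j,\ell}=r_{j,\ell}(x)=|x-z_{j,\ell}|$ for $x\in\Gamma_j$. (The quantities $R$, $\Gamma_j$, $z_{j,2}$ and $r_{j,\ell}$ depend on $k$ through the choice of $R$ and $\lambda_{j,2}$.) $\|\cdot\|_{j,\infty}$ denotes the norm of $L^\infty(\Gamma_j)$. The fundamental solution is $\Phi_k(x,y)=\frac{\mathrm{i}}{4}H_0^{(1)}(k|x-y|)$ for $x\neq y$ in $\mathbb{R}^2$. The radiated field of $S$ at wavenumber $k>0$ is the unique solution $u(\cdot,k)$ of $\Delta u+k^2u=S$ in $\mathbb{R}^2$ satisfying the Sommerfeld radiation condition $\frac{\partial u}{\partial r}-\mathrm{i}ku=o(r^{-1/2})$ as $r=|x|\to\infty$; it is given by $$u(x,k)=-\int_{V_0}\Phi_k(x,y)S(y)\,\mathrm{d}y.$$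 *)

theory Defs
  imports
    "HOL-Analysis.Analysis"
    "HOL-Probability.Essential_Supremum"
    "HOL-Library.Landau_Symbols"
begin

section \<open>Bessel and Hankel functions of order 0\<close>

definition bessel_J0 :: "real \<Rightarrow> real" where
  "bessel_J0 x = (\<Sum>n. (-1) ^ n / (fact n)\<^sup>2 * (x / 2) ^ (2 * n))"

text \<open>
  The standard expansion of \<open>Y\<^sub>0\<close>, valid for \<open>x > 0\<close>; \<open>harm n\<close> is the \<open>n\<close>-th harmonic number
  (with \<open>harm 0 = 0\<close>). It is the expansion that corresponds to
  \<open>H\<^sub>0\<close> being the outgoing solution, \<open>H\<^sub>0(x) \<sim> sqrt (2 / (\<pi> x)) exp (\<i> (x - \<pi>/4))\<close>.
\<close>
definition bessel_Y0 :: "real \<Rightarrow> real" where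
  "bessel_Y0 x = 2 / pi * (ln (x / 2) + euler_mascheroni) * bessel_J0 x
     - 2 / pi * (\<Sum>n. (-1) ^ n * harm n / (fact n)\<^sup>2 * (x / 2) ^ (2 * n))"

definition hankel_H0 :: "real \<Rightarrow> complex" where
  "hankel_H0 x = complex_of_real (bessel_J0 x) + \<i> * complex_of_real (bessel_Y0 x)"

definition Phi :: "real \<Rightarrow> real^2 \<Rightarrow> real^2 \<Rightarrow> complex" where
  "Phi k x y = \<i> / 4 * hankel_H0 (k * norm (x - y))"


section \<open>The radiated field\<close>

definition partial_deriv :: "2 \<Rightarrow> (real^2 \<Rightarrow> real) \<Rightarrow> real^2 \<Rightarrow> real" where
  "partial_deriv i f x = frechet_derivative f (at x) (axis i 1)"

definition laplacian :: "(real^2 \<Rightarrow> real) \<Rightarrow> real^2 \<Rightarrow> real" where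
  "laplacian f x = (\<Sum>i\<in>UNIV. partial_deriv i (partial_deriv i f) x)"

text \<open>
  Smooth functions with compact support: all iterated partial derivatives
  (\<open>is\<close> lists the directions) are again differentiable everywhere.
\<close>
definition test_function :: "(real^2 \<Rightarrow> real) \<Rightarrow> bool" where
  "test_function \<phi> \<longleftrightarrow>
     (\<forall>is x. foldr partial_deriv is \<phi> differentiable (at x)) \<and>
     (\<exists>K. compact K \<and> (\<forall>x. x \<notin> K \<longrightarrow> \<phi> x = 0))"

text \<open>
  \<open>\<Delta>u + k\<^sup>2 u = S\<close> in the sense of distributions; a source that is merely square integrable
  does not admit a classical solution.
\<close>
definition helmholtz_solution :: "real \<Rightarrow> (real^2 \<Rightarrow> complex) \<Rightarrow> (real^2 \<Rightarrow> complex) \<Rightarrow> bool" where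
  "helmholtz_solution k S u \<longleftrightarrow>
     (\<forall>\<phi>. test_function \<phi> \<longrightarrow>
        integral\<^sup>L lebesgue (\<lambda>x. u x * complex_of_real (laplacian \<phi> x + k\<^sup>2 * \<phi> x)) =
        integral\<^sup>L lebesgue (\<lambda>x. S x * complex_of_real (\<phi> x)))"

text \<open>
  The \<open>o\<close>-term is uniform in the direction \<open>x / |x|\<close>, as \<open>at_infinity\<close> is the filter
  \<open>|x| \<rightarrow> \<infinity>\<close>; \<open>u\<^sub>r\<close> is the radial derivative.
\<close>
definition sommerfeld :: "real \<Rightarrow> (real^2 \<Rightarrow> complex) \<Rightarrow> bool" where
  "sommerfeld k u \<longleftrightarrow>
     (\<exists>u\<^sub>r. (\<forall>\<^sub>F x in at_infinity.
              ((\<lambda>t. u (t *\<^sub>R (x /\<^sub>R norm x))) has_vector_derivative u\<^sub>r x) (at (norm x))) \<and>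
           (\<lambda>x. u\<^sub>r x - \<i> * complex_of_real k * u x)
             \<in> o[at_infinity](\<lambda>x. complex_of_real (norm x powr (-1/2))))"

text \<open>
  For \<open>S\<close> in \<open>L\<^sup>2\<close> with compact support the distributional solution lies in \<open>H\<^sup>2\<^sub>l\<^sub>o\<^sub>c\<close> and hence has a
  continuous representative, namely \<open>x \<mapsto> - \<integral> Phi k x y * S y dy\<close>. Requiring continuity selects
  this representative, so that restricting \<open>u\<close> to a curve is meaningful.
\<close>
definition radiated_field :: "real \<Rightarrow> (real^2 \<Rightarrow> complex) \<Rightarrow> (real^2 \<Rightarrow> complex) \<Rightarrow> bool" where
  "radiated_field k S u \<longleftrightarrow>
     continuous_on UNIV u \<and> helmholtz_solution k S u \<and> sommerfeld k u"

definition square_integrable :: "(real^2 \<Rightarrow> complex) \<Rightarrow> bool" where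
  "square_integrable S \<longleftrightarrow>
     S \<in> borel_measurable lebesgue \<and> integrable lebesgue (\<lambda>x. (norm (S x))\<^sup>2)"

definition supp_compactly_in :: "(real^2 \<Rightarrow> complex) \<Rightarrow> (real^2) set \<Rightarrow> bool" where
  "supp_compactly_in S V \<longleftrightarrow>
     (\<exists>K. compact K \<and> K \<subseteq> V \<and> (AE x in lebesgue. x \<notin> K \<longrightarrow> S x = 0))"

definition open_square :: "real \<Rightarrow> (real^2) set" where
  "open_square a = {x. \<forall>i. - a < x $ i \<and> x $ i < a}"


section \<open>Wavenumbers and measurement arcs\<close>

definition k_star :: "real \<Rightarrow> real" where
  "k_star a = pi / (30 * a)"

definition wavenumbers :: "real \<Rightarrow> nat \<Rightarrow> real set" where
  "wavenumbers a N =
     {pi / a * sqrt ((real_of_int l1)\<^sup>2 + (real_of_int l2)\<^sup>2) | l1 l2.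
        1 \<le> max \<bar>l1\<bar> \<bar>l2\<bar> \<and> max \<bar>l1\<bar> \<bar>l2\<bar> \<le> int N}
     \<union> {k_star a}"

definition polar :: "real \<Rightarrow> real \<Rightarrow> real^2" where
  "polar r \<theta> = r *\<^sub>R vector [cos \<theta>, sin \<theta>]"

definition angle :: "nat \<Rightarrow> real \<Rightarrow> real" where
  "angle m \<mu> = \<mu> * pi / real m"

definition arc_angles :: "nat \<Rightarrow> nat \<Rightarrow> real set" where
  "arc_angles m j = {angle m (2 * real j - 2) .. angle m (2 * real j)}"

definition Gamma_arc :: "nat \<Rightarrow> real \<Rightarrow> nat \<Rightarrow> (real^2) set" where
  "Gamma_arc m R j = polar R ` arc_angles m j"

text \<open>
  The norm of \<open>L\<^sup>\<infinity>\<close> on \<open>Gamma_arc m R j\<close>, computed in the parametrisation by the angle. Arc length is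
  \<open>R d\<theta>\<close>, so for \<open>R > 0\<close> null sets, measurability and hence the essential supremum are those
  of arc length. The value is \<open>\<infinity>\<close> for functions outside \<open>L\<^sup>\<infinity>\<close>, including
  non-measurable ones: a bound by a finite number therefore entails membership. (Measurability is
  required of \<open>f\<close> itself because \<open>esssup\<close> would only see that of \<open>|f|\<close>.)
\<close>
definition arc_Linf :: "nat \<Rightarrow> real \<Rightarrow> nat \<Rightarrow> (real^2 \<Rightarrow> 'a::real_normed_vector) \<Rightarrow> ennreal" where
  "arc_Linf m R j f =
     (if (\<lambda>\<theta>. f (polar R \<theta>)) \<in> borel_measurable (lebesgue_on (arc_angles m j))
      then esssup (lebesgue_on (arc_angles m j)) (\<lambda>\<theta>. ennreal (norm (f (polar R \<theta>))))
      else \<infinity>)"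

end

theory Submission
  imports Defs
begin

text \<open>
  On the arc, \<open>|v|\<^sup>2 - |u|\<^sup>2\<close> is affine in \<open>u\<close>, so each reference source gives one linear equation for
  \<open>(Re u, Im u)\<close>; noise in \<open>p\<close> and \<open>q\<close> only perturbs its right-hand side. The determinant of the two
  equations is \<open>J\<^sub>0(y) Y\<^sub>0(x) - J\<^sub>0(x) Y\<^sub>0(y)\<close> with \<open>x = k r\<^sub>1\<close>, \<open>y = k r\<^sub>2\<close>, and everything reduces to
  bounding it from below against the moduli of the two Hankel functions.

  For \<open>k \<noteq> k\<^sup>*\<close> no asymptotic expansion is needed. As a function of \<open>x\<close>, the determinant times
  \<open>sqrt x\<close> solves \<open>w'' + (1 + 1 / (4 x\<^sup>2)) w = 0\<close> and vanishes at \<open>x = y\<close> with a slope given by the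
  Wronskian, so it is close to a multiple of \<open>sin (x - y)\<close>; the second source is placed so that
  \<open>x - y\<close> stays near \<open>\<pi> / 2\<close> on the arc. A decreasing energy of the same equation
  bounds \<open>x |H\<^sub>0(x)|\<^sup>2\<close> by its value at 2. For \<open>k = k\<^sup>*\<close> the arguments are small and
  alternating power series suffice.
\<close>

section \<open>Power series, differential equation and Wronskian\<close>

text \<open>Coefficients in the variable \<open>z = (x / 2)\<^sup>2\<close>: there both series are
  entire and can be differentiated termwise everywhere, while the logarithm of
  \<open>bessel_Y0\<close> stays outside.\<close>

definition cJ :: "nat \<Rightarrow> real" where
  "cJ n = (-1) ^ n / (fact n)\<^sup>2"

definition cY :: "nat \<Rightarrow> real" where
  "cY n = (-1) ^ n * harm n / (fact n)\<^sup>2"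

definition pser :: "(nat \<Rightarrow> real) \<Rightarrow> real \<Rightarrow> real" where
  "pser c z = (\<Sum>n. c n * z ^ n)"

lemma bessel_J0_pser: "bessel_J0 x = pser cJ ((x / 2)\<^sup>2)"
  by (simp add: bessel_J0_def pser_def cJ_def power_mult)

lemma bessel_Y0_pser:
  "bessel_Y0 x = 2 / pi * ((ln (x / 2) + euler_mascheroni) * pser cJ ((x / 2)\<^sup>2) - pser cY ((x / 2)\<^sup>2))"
  by (simp add: bessel_Y0_def bessel_J0_pser pser_def cY_def power_mult right_diff_distrib mult.assoc)

text \<open>A crude bound that lets one factorial of \<open>(fact n)\<^sup>2\<close> absorb
  \<open>harm n\<close>, leaving a term of the exponential series.\<close>

lemma harm_le_fact: "harm n \<le> (fact n :: real)"
proof (induction n)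
  case (Suc n)
  show ?case
  proof (cases "n = 0")
    case False
    have "inverse (1 + real n) \<le> 1" by (simp add: inverse_eq_divide)
    also have "\<dots> \<le> real n * fact n"
      using mult_mono[of 1 "real n" 1 "fact n"] False by (simp add: fact_ge_1)
    finally have "harm n + inverse (1 + real n) \<le> fact n + real n * fact n" using Suc by simp
    then show ?thesis by (simp add: harm_Suc algebra_simps)
  qed (simp add: harm_Suc harm_def)
qed (simp add: harm_def)

lemma summable_of_le_fact:
  fixes c :: "nat \<Rightarrow> real"
  assumes "\<And>n. \<bar>c n\<bar> \<le> 1 / fact n"
  shows "summable (\<lambda>n. c n * z ^ n)"
proof (rule summable_comparison_test')
  show "summable (\<lambda>n. \<bar>z\<bar> ^ n / fact n)"
    using summable_exp[of "\<bar>z\<bar>"] by (simp add: inverse_eq_divide)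
  show "norm (c n * z ^ n) \<le> \<bar>z\<bar> ^ n / fact n" if "n \<ge> 0" for n
    using mult_right_mono[OF assms[of n], of "\<bar>z\<bar> ^ n"] by (simp add: abs_mult power_abs)
qed

lemma summable_cJ: "summable (\<lambda>n. cJ n * z ^ n)"
proof (rule summable_of_le_fact)
  fix n
  have "(fact n :: real) \<le> (fact n)\<^sup>2"
    using fact_ge_1[of n, where 'a = real] by (simp add: self_le_power)
  then show "\<bar>cJ n\<bar> \<le> 1 / fact n"
    by (simp add: cJ_def abs_mult power_abs frac_le)
qed

lemma summable_cY: "summable (\<lambda>n. cY n * z ^ n)"
proof (rule summable_of_le_fact)
  fix n
  have "0 \<le> (harm n :: real)" by (simp add: harm_nonneg)
  then have "\<bar>cY n\<bar> = harm n / (fact n)\<^sup>2"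
    by (simp add: cY_def abs_mult power_abs)
  also have "\<dots> \<le> fact n / (fact n)\<^sup>2"
    by (intro divide_right_mono harm_le_fact) simp
  finally show "\<bar>cY n\<bar> \<le> 1 / fact n" by (simp add: power2_eq_square)
qed

lemma pser_deriv:
  assumes "\<And>y. summable (\<lambda>n. c n * y ^ n)"
  shows "(pser c has_real_derivative pser (diffs c) z) (at z)"
  unfolding pser_def by (rule termdiffs_strong_converges_everywhere[OF assms])

lemma summable_diffs:
  fixes c :: "nat \<Rightarrow> real"
  assumes "\<And>y. summable (\<lambda>n. c n * y ^ n)"
  shows "summable (\<lambda>n. diffs c n * z ^ n)"
  by (rule termdiff_converges_all) (rule assms)

text \<open>The operator \<open>z d/dz\<close> multiplies the \<open>n\<close>-th coefficient by
  \<open>n\<close>, so differential equations become recurrences for coefficients.\<close>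

lemma pser_euler:
  assumes "\<And>y. summable (\<lambda>n. c n * y ^ n)"
  shows "(\<lambda>n. real n * c n * z ^ n) sums (z * pser (diffs c) z)"
proof -
  have "(\<lambda>n. z * (real n * c n * z ^ (n - Suc 0))) sums (z * pser (diffs c) z)"
    unfolding pser_def by (intro sums_mult diffs_equiv summable_diffs assms)
  moreover have "(\<lambda>n. z * (real n * c n * z ^ (n - Suc 0))) = (\<lambda>n. real n * c n * z ^ n)"
  proof
    show "z * (real n * c n * z ^ (n - Suc 0)) = real n * c n * z ^ n" for n
      by (cases n) auto
  qed
  ultimately show ?thesis by simp
qed

lemma pser_sums: "(\<And>y. summable (\<lambda>n. c n * y ^ n)) \<Longrightarrow> (\<lambda>n. c n * z ^ n) sums pser c z"
  unfolding pser_def by (rule summable_sums)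

text \<open>Since \<open>diffs c n\<close> is \<open>(n + 1) * c (n + 1)\<close>, this is the
  two-term recurrence of the series: the differential equation read coefficient by
  coefficient.\<close>

lemma diffs_cJ: "real (Suc n) * diffs cJ n = - cJ n"
  by (simp add: diffs_def cJ_def power2_eq_square divide_simps)

text \<open>The increment \<open>1 / (n + 1)\<close> of the harmonic number yields the extra term
  \<open>diffs cJ n\<close>.\<close>

lemma diffs_cY: "real (Suc n) * diffs cY n = diffs cJ n - cY n"
  by (simp add: diffs_def cJ_def cY_def power2_eq_square divide_simps harm_Suc) (simp add: algebra_simps)

lemma pser_cJ_ode: "z * pser (diffs (diffs cJ)) z + pser (diffs cJ) z + pser cJ z = 0"
proof -
  have "(\<lambda>n. real n * diffs cJ n * z ^ n + diffs cJ n * z ^ n + cJ n * z ^ n)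
          sums (z * pser (diffs (diffs cJ)) z + pser (diffs cJ) z + pser cJ z)"
    by (intro sums_add pser_euler pser_sums summable_diffs summable_cJ)
  moreover have "real n * diffs cJ n * z ^ n + diffs cJ n * z ^ n + cJ n * z ^ n = 0" for n
  proof -
    have "real n * diffs cJ n * z ^ n + diffs cJ n * z ^ n + cJ n * z ^ n
        = (real (Suc n) * diffs cJ n + cJ n) * z ^ n"
      by (simp add: algebra_simps)
    then show ?thesis by (simp only: diffs_cJ) simp
  qed
  ultimately have "(\<lambda>n. 0) sums (z * pser (diffs (diffs cJ)) z + pser (diffs cJ) z + pser cJ z)"
    by simp
  then show ?thesis by (metis sums_unique2 sums_zero)
qed

text \<open>The right-hand side is also what the same operator produces from the logarithm times
  \<open>pser cJ\<close>; the two cancel in \<open>bessel_Y0\<close>, which is why harmonic numbers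
  appear there.\<close>

lemma pser_cY_ode:
  "z * pser (diffs (diffs cY)) z + pser (diffs cY) z + pser cY z = pser (diffs cJ) z"
proof -
  have "(\<lambda>n. real n * diffs cY n * z ^ n + diffs cY n * z ^ n + cY n * z ^ n)
          sums (z * pser (diffs (diffs cY)) z + pser (diffs cY) z + pser cY z)"
    by (intro sums_add pser_euler pser_sums summable_diffs summable_cY)
  moreover have "real n * diffs cY n * z ^ n + diffs cY n * z ^ n + cY n * z ^ n
      = diffs cJ n * z ^ n" for n
  proof -
    have "real n * diffs cY n * z ^ n + diffs cY n * z ^ n + cY n * z ^ n
        = (real (Suc n) * diffs cY n + cY n) * z ^ n"
      by (simp add: algebra_simps)
    then show ?thesis by (simp only: diffs_cY) simp
  qed
  ultimately have "(\<lambda>n. diffs cJ n * z ^ n)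
      sums (z * pser (diffs (diffs cY)) z + pser (diffs cY) z + pser cY z)"
    by simp
  then show ?thesis
    by (rule sums_unique2) (intro pser_sums summable_diffs summable_cJ)
qed

lemma pser_cJ_deriv: "(pser cJ has_real_derivative pser (diffs cJ) z) (at z)"
  and pser_cY_deriv: "(pser cY has_real_derivative pser (diffs cY) z) (at z)"
  and pser_cJ_deriv2: "(pser (diffs cJ) has_real_derivative pser (diffs (diffs cJ)) z) (at z)"
  and pser_cY_deriv2: "(pser (diffs cY) has_real_derivative pser (diffs (diffs cY)) z) (at z)"
  by (intro pser_deriv summable_diffs summable_cJ summable_cY)+

lemma pser_0: "pser c 0 = c 0"
  by (simp add: pser_def powser_zero)

text \<open>By the two equations the left-hand side has derivative 0, so it equals its value at 0.
  Up to a factor it is the Wronskian with the logarithm cancelled, hence it can be evaluated at the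
  singular point.\<close>

lemma pser_wronskian:
  "(pser cJ z)\<^sup>2 + 2 * z * (pser (diffs cJ) z * pser cY z - pser cJ z * pser (diffs cY) z) = 1"
proof -
  define W where "W = (\<lambda>z. (pser cJ z)\<^sup>2
     + 2 * z * (pser (diffs cJ) z * pser cY z - pser cJ z * pser (diffs cY) z))"
  have "(W has_real_derivative 0) (at y)" for y
  proof -
    let ?A = "pser cJ y" and ?A1 = "pser (diffs cJ) y" and ?A2 = "pser (diffs (diffs cJ)) y"
      and ?B = "pser cY y" and ?B1 = "pser (diffs cY) y" and ?B2 = "pser (diffs (diffs cY)) y"
    have "(W has_real_derivative
        2 * ?A * ?A1 + 2 * (?A1 * ?B - ?A * ?B1) + 2 * ((y * ?A2) * ?B - ?A * (y * ?B2))) (at y)"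
    proof -
      have "((\<lambda>y. 2 * y) has_real_derivative 2) (at y)"
        by (auto intro!: derivative_eq_intros)
      note prod = DERIV_mult[OF this DERIV_diff[OF DERIV_mult[OF pser_cJ_deriv2 pser_cY_deriv]
          DERIV_mult[OF pser_cJ_deriv pser_cY_deriv2]]]
      show ?thesis
        unfolding W_def power2_eq_square
        by (rule DERIV_cong[OF DERIV_add[OF DERIV_mult[OF pser_cJ_deriv pser_cJ_deriv] prod]])
          (simp add: algebra_simps)
    qed
    moreover have "y * ?A2 = - ?A1 - ?A" "y * ?B2 = ?A1 - ?B1 - ?B"
      using pser_cJ_ode[of y] pser_cY_ode[of y] by simp_all
    ultimately show ?thesis by (simp add: algebra_simps)
  qed
  then have "W z = W 0" by (intro DERIV_isconst_all) auto
  also have "\<dots> = 1" by (simp add: W_def pser_0 cJ_def)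
  finally show ?thesis by (simp add: W_def)
qed

section \<open>Derivatives, Bessel's equation and Wronskian in the original variable\<close>

definition bessel_J0' :: "real \<Rightarrow> real" where
  "bessel_J0' x = x / 2 * pser (diffs cJ) ((x / 2)\<^sup>2)"

text \<open>The summand with \<open>pser cJ\<close> divided by \<open>x\<close> comes from
  differentiating the logarithm; the rest is the chain rule in \<open>z\<close>.\<close>

definition bessel_Y0' :: "real \<Rightarrow> real" where
  "bessel_Y0' x = 2 / pi * (pser cJ ((x / 2)\<^sup>2) / x
     + x / 2 * ((ln (x / 2) + euler_mascheroni) * pser (diffs cJ) ((x / 2)\<^sup>2) - pser (diffs cY) ((x / 2)\<^sup>2)))"

lemma pser_comp_deriv:
  assumes "\<And>z. (pser c has_real_derivative d z) (at z)"
  shows "((\<lambda>x. pser c ((x / 2)\<^sup>2)) has_real_derivative x / 2 * d ((x / 2)\<^sup>2)) (at x)"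
proof -
  have "((\<lambda>x. (x / 2)\<^sup>2) has_real_derivative x / 2) (at x)"
    by (rule derivative_eq_intros refl | simp)+
  from DERIV_chain2[OF assms this] show ?thesis by (simp add: mult.commute)
qed

lemmas pser_comp_derivs = pser_comp_deriv[OF pser_cJ_deriv] pser_comp_deriv[OF pser_cY_deriv]
  pser_comp_deriv[OF pser_cJ_deriv2] pser_comp_deriv[OF pser_cY_deriv2]

lemma bessel_J0_deriv: "(bessel_J0 has_real_derivative bessel_J0' x) (at x)"
  unfolding bessel_J0_pser[abs_def] bessel_J0'_def by (rule pser_comp_derivs)

lemma ln_half_deriv:
  "x > 0 \<Longrightarrow> ((\<lambda>x. ln (x / 2) + C) has_real_derivative 1 / x) (at x)"
  by (auto intro!: derivative_eq_intros)

lemma half_deriv: "((\<lambda>x::real. x / 2) has_real_derivative 1 / 2) (at x)"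
  by (auto intro!: derivative_eq_intros)

lemma bessel_Y0_deriv:
  assumes "x > 0"
  shows "(bessel_Y0 has_real_derivative bessel_Y0' x) (at x)"
  unfolding bessel_Y0_pser[abs_def]
  by (rule DERIV_cong[OF DERIV_cmult[OF DERIV_diff[OF DERIV_mult[OF
        ln_half_deriv[OF assms] pser_comp_derivs(1)] pser_comp_derivs(2)]]])
    (simp add: bessel_Y0'_def algebra_simps)

lemma bessel_J0'_deriv:
  assumes "x > 0"
  shows "(bessel_J0' has_real_derivative - bessel_J0' x / x - bessel_J0 x) (at x)"
proof -
  let ?z = "(x / 2)\<^sup>2"
  have "(bessel_J0' has_real_derivative
      1 / 2 * pser (diffs cJ) ?z + x / 2 * pser (diffs (diffs cJ)) ?z * (x / 2)) (at x)"
    unfolding bessel_J0'_def[abs_def]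
    by (rule DERIV_mult[OF half_deriv pser_comp_derivs(3)])
  moreover have "pser (diffs (diffs cJ)) ?z = (- pser (diffs cJ) ?z - pser cJ ?z) / ?z"
    using pser_cJ_ode[of ?z] assms by (simp add: eq_divide_eq) (simp add: algebra_simps)
  moreover have "1 / 2 * A1 + x / 2 * ((- A1 - A) / ?z) * (x / 2) = - (x / 2 * A1) / x - A" for A A1
    using assms by (simp add: field_simps power2_eq_square)
  ultimately show ?thesis
    by (simp only: bessel_J0'_def bessel_J0_pser)
qed

text \<open>Bessel's equation again: what the derivatives of the logarithm contribute cancels
  against the right-hand side of \<open>pser_cY_ode\<close>.\<close>

lemma bessel_Y0'_deriv:
  assumes "x > 0"
  shows "(bessel_Y0' has_real_derivative - bessel_Y0' x / x - bessel_Y0 x) (at x)"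
proof -
  let ?z = "(x / 2)\<^sup>2" and ?L = "ln (x / 2) + euler_mascheroni"
  have "x \<noteq> 0" using assms by simp
  have "(bessel_Y0' has_real_derivative
      2 / pi * ((x / 2 * pser (diffs cJ) ?z * x - pser cJ ?z * 1) / (x * x)
        + (1 / 2 * (?L * pser (diffs cJ) ?z - pser (diffs cY) ?z)
          + (1 / x * pser (diffs cJ) ?z + x / 2 * pser (diffs (diffs cJ)) ?z * ?L
             - x / 2 * pser (diffs (diffs cY)) ?z) * (x / 2)))) (at x)"
    unfolding bessel_Y0'_def[abs_def]
    by (rule DERIV_cmult[OF DERIV_add[OF
          DERIV_divide[OF pser_comp_derivs(1) DERIV_ident \<open>x \<noteq> 0\<close>]
          DERIV_mult[OF half_deriv DERIV_diff[OF DERIV_mult[OF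
            ln_half_deriv[OF assms] pser_comp_derivs(3)] pser_comp_derivs(4)]]]])
  moreover have "pser (diffs (diffs cJ)) ?z = (- pser (diffs cJ) ?z - pser cJ ?z) / ?z"
    using pser_cJ_ode[of ?z] assms by (simp add: eq_divide_eq) (simp add: algebra_simps)
  moreover have "pser (diffs (diffs cY)) ?z
      = (pser (diffs cJ) ?z - pser (diffs cY) ?z - pser cY ?z) / ?z"
    using pser_cY_ode[of ?z] assms by (simp add: eq_divide_eq) (simp add: algebra_simps)
  moreover have "P * ((x / 2 * A1 * x - A * 1) / (x * x) + (1 / 2 * (L * A1 - B1)
        + (1 / x * A1 + x / 2 * ((- A1 - A) / ?z) * L - x / 2 * ((A1 - B1 - B) / ?z)) * (x / 2)))
      = - (P * (A / x + x / 2 * (L * A1 - B1))) / x - P * (L * A - B)" for P A A1 B B1 L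
    using assms by (simp add: field_simps power2_eq_square)
  ultimately show ?thesis
    by (simp only: bessel_Y0'_def bessel_Y0_pser)
qed

text \<open>The terms with \<open>ln (x / 2) + euler_mascheroni\<close> cancel, leaving
  \<open>2 / (pi * x)\<close> times the constant of \<open>pser_wronskian\<close>.\<close>

lemma bessel_wronskian:
  assumes "x > 0"
  shows "bessel_J0 x * bessel_Y0' x - bessel_J0' x * bessel_Y0 x = 2 / (pi * x)"
proof -
  let ?z = "(x / 2)\<^sup>2"
  have "A * (2 / P * (A / x + x / 2 * (L * A1 - B1))) - x / 2 * A1 * (2 / P * (L * A - B))
      = 2 / (P * x) * (A\<^sup>2 + 2 * ?z * (A1 * B - A * B1))" if "P \<noteq> 0" for P A A1 B B1 L
    using assms that by (simp add: power2_eq_square field_simps)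
  then have "bessel_J0 x * bessel_Y0' x - bessel_J0' x * bessel_Y0 x = 2 / (pi * x) *
    ((pser cJ ?z)\<^sup>2 + 2 * ?z * (pser (diffs cJ) ?z * pser cY ?z - pser cJ ?z * pser (diffs cY) ?z))"
    unfolding bessel_J0_pser bessel_Y0_pser bessel_J0'_def bessel_Y0'_def by simp
  then show ?thesis by (simp add: pser_wronskian)
qed

section \<open>The modulus and the cross product\<close>

text \<open>
  \<open>|w'|\<^sup>2 + (1 + 1 / (4 x\<^sup>2)) |w|\<^sup>2\<close> for \<open>w = sqrt x C\<close>, written in terms of \<open>C\<close>.
\<close>
definition energy :: "(real \<Rightarrow> real) \<Rightarrow> (real \<Rightarrow> real) \<Rightarrow> real \<Rightarrow> real" where
  "energy C C' x = x * (C' x)\<^sup>2 + C x * C' x + (x + 1 / (2 * x)) * (C x)\<^sup>2"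

text \<open>Only the coefficient \<open>1 + 1 / (4 x\<^sup>2)\<close> depends explicitly on
  \<open>x\<close>, and it decreases; the derivative of the energy comes out as
  \<open>- (C x / x)\<^sup>2 / 2\<close>.\<close>

lemma energy_decreasing:
  assumes C: "\<And>x. x > 0 \<Longrightarrow> (C has_real_derivative C' x) (at x)"
    and C': "\<And>x. x > 0 \<Longrightarrow> (C' has_real_derivative - C' x / x - C x) (at x)"
    and "0 < x" "x \<le> y"
  shows "energy C C' y \<le> energy C C' x"
proof (rule DERIV_nonpos_imp_nonincreasing[OF \<open>x \<le> y\<close>])
  fix t assume "x \<le> t" "t \<le> y"
  then have t: "t > 0" using \<open>0 < x\<close> by simp
  have inv: "((\<lambda>x. x + 1 / (2 * x)) has_real_derivative 1 - 1 / (2 * t\<^sup>2)) (at t)"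
    using t by (auto intro!: derivative_eq_intros simp: power2_eq_square field_simps)
  have "(energy C C' has_real_derivative
      (1 * (C' t * C' t) + ((- C' t / t - C t) * C' t + (- C' t / t - C t) * C' t) * t
       + (C' t * C' t + (- C' t / t - C t) * C t))
       + ((1 - 1 / (2 * t\<^sup>2)) * (C t * C t) + (C' t * C t + C' t * C t) * (t + 1 / (2 * t)))) (at t)"
    unfolding energy_def[abs_def] power2_eq_square
    by (rule DERIV_cong[OF DERIV_add[OF DERIV_add[OF DERIV_mult[OF DERIV_ident
            DERIV_mult[OF C'[OF t] C'[OF t]]] DERIV_mult[OF C[OF t] C'[OF t]]]
          DERIV_mult[OF inv DERIV_mult[OF C[OF t] C[OF t]]]]])
      (simp add: power2_eq_square)
  moreover have "(1 * (C' t * C' t) + ((- C' t / t - C t) * C' t + (- C' t / t - C t) * C' t) * t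
       + (C' t * C' t + (- C' t / t - C t) * C t))
       + ((1 - 1 / (2 * t\<^sup>2)) * (C t * C t) + (C' t * C t + C' t * C t) * (t + 1 / (2 * t)))
      = - (C t / t)\<^sup>2 / 2"
    using t by (simp add: power2_eq_square field_simps)
  ultimately have "(energy C C' has_real_derivative - (C t / t)\<^sup>2 / 2) (at t)" by simp
  then show "\<exists>d. (energy C C' has_real_derivative d) (at t) \<and> d \<le> 0"
    by (intro exI conjI) auto
qed

text \<open>The difference is the sum of squares
  \<open>(w')\<^sup>2 + w\<^sup>2 / (4 x\<^sup>2)\<close> with \<open>w = sqrt x C\<close>.\<close>

lemma energy_ge:
  assumes "x > 0"
  shows "x * (C x)\<^sup>2 \<le> energy C C' x"
proof -
  have "energy C C' x - x * (C x)\<^sup>2 = x * (C' x + C x / (2 * x))\<^sup>2 + (C x)\<^sup>2 / (4 * x)"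
    using assms by (simp add: energy_def power2_eq_square field_simps)
  moreover have "0 \<le> x * (C' x + C x / (2 * x))\<^sup>2 + (C x)\<^sup>2 / (4 * x)"
    using assms by simp
  ultimately show ?thesis by simp
qed

section \<open>Explicit bounds from alternating series\<close>

lemma alternating_series_bounds:
  fixes a :: "nat \<Rightarrow> real"
  assumes "a \<longlonglongrightarrow> 0" "\<And>n. 0 \<le> a n" "\<And>n. a (Suc n) \<le> a n"
  shows "(\<Sum>n. (-1) ^ n * a n) \<in> {a 0 - a 1 + a 2 - a 3..a 0 - a 1 + a 2}"
  using summable_Leibniz'(2)[OF assms, of 2] summable_Leibniz'(4)[OF assms, of 1]
  by (simp add: eval_nat_numeral)

text \<open>With \<open>z\<close> in the unit interval the decrease of the coefficients passes to
  the terms, so Leibniz's criterion brackets the sum between its partial sums of four and of three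
  terms.\<close>

lemma alternating_power_series_bounds:
  assumes summ: "\<And>y. summable (\<lambda>n. c n * y ^ n)"
    and c: "\<And>n. c n = (-1) ^ n * a n"
    and pos: "\<And>n. 0 \<le> a n" and dec: "\<And>n. a (Suc n) \<le> a n" and z: "0 \<le> z" "z \<le> 1"
  shows "pser c z \<in> {a 0 - a 1 * z + a 2 * z\<^sup>2 - a 3 * z ^ 3..a 0 - a 1 * z + a 2 * z\<^sup>2}"
proof -
  let ?t = "\<lambda>n. a n * z ^ n"
  have eq: "c n * z ^ n = (-1) ^ n * ?t n" for n by (simp add: c)
  have "(\<lambda>n. norm (c n * z ^ n)) \<longlonglongrightarrow> 0"
    by (intro tendsto_norm_zero summable_LIMSEQ_zero summ)
  moreover have "norm (c n * z ^ n) = ?t n" for n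
    using pos[of n] z by (simp add: c abs_mult power_abs)
  ultimately have lim: "?t \<longlonglongrightarrow> 0" by simp
  have "a (Suc n) * z ^ Suc n \<le> a n * z ^ n" for n
    using z by (intro mult_mono dec pos power_decreasing) auto
  from alternating_series_bounds[OF lim _ this] pos z show ?thesis
    by (simp add: pser_def eq)
qed

lemma pser_cJ_bounds:
  assumes "0 \<le> z" "z \<le> 1"
  shows "pser cJ z \<in> {1 - z + z\<^sup>2 / 4 - z ^ 3 / 36..1 - z + z\<^sup>2 / 4}"
proof -
  have dec: "1 / (fact (Suc n))\<^sup>2 \<le> 1 / (fact n :: real)\<^sup>2" for n
    by (intro divide_left_mono power_mono mult_pos_pos) (auto simp: fact_mono)
  show ?thesis
    using alternating_power_series_bounds[of cJ "\<lambda>n. 1 / (fact n)\<^sup>2", OF summable_cJ _ _ dec assms]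
    by (simp add: cJ_def eval_nat_numeral)
qed

lemma pser_diffs_cJ_bounds:
  assumes "0 \<le> z" "z \<le> 1"
  shows "- pser (diffs cJ) z \<in> {1 - z / 2 + z\<^sup>2 / 12 - z ^ 3 / 144..1 - z / 2 + z\<^sup>2 / 12}"
proof -
  let ?a = "\<lambda>n. 1 / (fact n * fact (Suc n)) :: real"
  have "?a (Suc n) \<le> ?a n" for n
    by (intro divide_left_mono mult_mono mult_pos_pos fact_mono) (auto simp del: fact_Suc)
  moreover have "summable (\<lambda>n. - diffs cJ n * y ^ n)" for y
    using summable_minus[OF summable_diffs[OF summable_cJ], of y] by simp
  moreover have "- diffs cJ n = (-1) ^ n * ?a n" for n
    by (simp add: diffs_def cJ_def power2_eq_square)
  ultimately have "pser (\<lambda>n. - diffs cJ n) z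
      \<in> {?a 0 - ?a 1 * z + ?a 2 * z\<^sup>2 - ?a 3 * z ^ 3..?a 0 - ?a 1 * z + ?a 2 * z\<^sup>2}"
    using assms by (intro alternating_power_series_bounds) auto
  moreover have "pser (\<lambda>n. - diffs cJ n) z = - pser (diffs cJ) z"
    by (simp add: pser_def suminf_minus[OF summable_diffs[OF summable_cJ], symmetric])
  ultimately show ?thesis
    by (simp add: eval_nat_numeral)
qed

lemma harm_Suc_le: "harm (Suc n) \<le> real (Suc n) * harm n" if "n > 0"
proof -
  have "1 \<le> (harm n :: real)"
    using harm_mono[of 1 n, where 'a = real] that by (simp add: harm_expand)
  moreover from this have "1 \<le> real n * harm n"
    using that mult_mono[of 1 "real n" 1 "harm n :: real"] by simp
  moreover have "inverse (real (Suc n)) \<le> 1" by (simp add: inverse_eq_divide)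
  ultimately show ?thesis by (simp add: harm_Suc algebra_simps)
qed

text \<open>Serves two series: directly that of \<open>diffs cY\<close>, and, after dividing out the
  growing index, that of \<open>cY\<close> shifted by one. The index starts at 1 because
  \<open>harm 0 = 0\<close> breaks monotonicity.\<close>

lemma harm_fact_decreasing:
  "harm (Suc (Suc n)) / (fact (Suc (Suc n)))\<^sup>2 * real (Suc (Suc n))
     \<le> harm (Suc n) / (fact (Suc n))\<^sup>2 * real (Suc n)"
proof -
  have h: "0 \<le> (harm (Suc n) :: real)" by (rule harm_nonneg)
  have "harm (Suc (Suc n)) \<le> real (Suc (Suc n)) * harm (Suc n)" by (intro harm_Suc_le) simp
  also have "\<dots> \<le> real (Suc (Suc n)) * real (Suc n) * harm (Suc n)"
    using h by (simp add: mult_right_mono)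
  finally have "harm (Suc (Suc n)) * real (Suc (Suc n))
      \<le> real (Suc (Suc n)) * real (Suc n) * harm (Suc n) * real (Suc (Suc n))"
    by (rule mult_right_mono) simp
  then have "harm (Suc (Suc n)) * real (Suc (Suc n))
      \<le> (real (Suc (Suc n)))\<^sup>2 * (harm (Suc n) * real (Suc n))"
    by (simp only: power2_eq_square ac_simps)
  moreover have "(fact (Suc (Suc n)))\<^sup>2 = (real (Suc (Suc n)))\<^sup>2 * (fact (Suc n))\<^sup>2"
    by (subst fact_Suc) (simp only: power_mult_distrib of_nat_mult)
  ultimately show ?thesis
    by (simp add: field_simps del: fact_Suc of_nat_Suc)
qed

text \<open>As \<open>cY 0 = 0\<close>, the moduli of the coefficients do not decrease from the
  start; pulling out one factor \<open>z\<close> gives a sequence that does.\<close>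

lemma pser_cY_split: "pser cY z = z * pser (\<lambda>n. cY (Suc n)) z"
proof -
  have "(\<lambda>n. cY (Suc n) * z ^ Suc n) sums (pser cY z - cY 0)"
    using pser_sums[OF summable_cY, of z] by (subst sums_Suc_iff) simp
  moreover have "summable (\<lambda>n. cY (Suc n) * z ^ n)"
    using summable_cY[of z] summable_powser_split_head by blast
  then have "(\<lambda>n. z * (cY (Suc n) * z ^ n)) sums (z * pser (\<lambda>n. cY (Suc n)) z)"
    unfolding pser_def by (intro sums_mult summable_sums)
  ultimately show ?thesis
    by (simp add: cY_def harm_def sums_unique2 mult.left_commute)
qed

lemma pser_cY_bounds:
  assumes "0 \<le> z" "z \<le> 1"
  shows "- pser cY z \<in> {z - 3 / 8 * z\<^sup>2..z - 3 / 8 * z\<^sup>2 + 11 / 216 * z ^ 3}"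
proof -
  let ?a = "\<lambda>n. harm (Suc n) / (fact (Suc n))\<^sup>2 :: real"
  have "?a (Suc n) \<le> ?a n" for n
  proof -
    have "?a (Suc n) * real (Suc n) \<le> ?a (Suc n) * real (Suc (Suc n))"
      by (intro mult_left_mono) (auto simp: harm_nonneg)
    also have "\<dots> \<le> ?a n * real (Suc n)" by (rule harm_fact_decreasing)
    finally show ?thesis by (rule mult_right_le_imp_le) simp
  qed
  moreover have "summable (\<lambda>n. - cY (Suc n) * y ^ n)" for y
    using summable_cY[of y] summable_powser_split_head[of cY y] summable_minus by fastforce
  moreover have "- cY (Suc n) = (-1) ^ n * ?a n" for n
    by (simp add: cY_def)
  ultimately have "pser (\<lambda>n. - cY (Suc n)) z
      \<in> {?a 0 - ?a 1 * z + ?a 2 * z\<^sup>2 - ?a 3 * z ^ 3..?a 0 - ?a 1 * z + ?a 2 * z\<^sup>2}"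
    using assms by (intro alternating_power_series_bounds) (auto simp: harm_nonneg)
  moreover have "pser (\<lambda>n. - cY (Suc n)) z = - pser (\<lambda>n. cY (Suc n)) z"
    using summable_cY[of z] summable_powser_split_head[of cY z] by (simp add: pser_def suminf_minus)
  ultimately have b: "- pser (\<lambda>n. cY (Suc n)) z
      \<in> {1 - 3 / 8 * z + 11 / 216 * z\<^sup>2 - 25 / 6912 * z ^ 3..1 - 3 / 8 * z + 11 / 216 * z\<^sup>2}"
    by (simp add: eval_nat_numeral harm_expand harm_Suc)
  have "25 / 6912 * z ^ 3 \<le> 11 / 216 * z\<^sup>2"
    using assms by (intro mult_mono power_decreasing) auto
  with b have "1 - 3 / 8 * z \<le> - pser (\<lambda>n. cY (Suc n)) z"
    "- pser (\<lambda>n. cY (Suc n)) z \<le> 1 - 3 / 8 * z + 11 / 216 * z\<^sup>2" by auto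
  from this[THEN mult_left_mono, OF assms(1)] show ?thesis
    by (simp add: pser_cY_split[of z] power2_eq_square power3_eq_cube algebra_simps)
qed

lemma pser_diffs_cY_bounds:
  assumes "0 \<le> z" "z \<le> 1"
  shows "- pser (diffs cY) z \<in> {1 - 3 / 4 * z + 11 / 72 * z\<^sup>2 - 25 / 1728 * z ^ 3..1 - 3 / 4 * z + 11 / 72 * z\<^sup>2}"
proof -
  let ?a = "\<lambda>n. harm (Suc n) / (fact (Suc n))\<^sup>2 * real (Suc n)"
  have "summable (\<lambda>n. - diffs cY n * y ^ n)" for y
    using summable_minus[OF summable_diffs[OF summable_cY], of y] by simp
  moreover have "- diffs cY n = (-1) ^ n * ?a n" for n
    by (simp add: diffs_def cY_def del: fact_Suc)
  ultimately have "pser (\<lambda>n. - diffs cY n) z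
      \<in> {?a 0 - ?a 1 * z + ?a 2 * z\<^sup>2 - ?a 3 * z ^ 3..?a 0 - ?a 1 * z + ?a 2 * z\<^sup>2}"
    using assms harm_fact_decreasing by (intro alternating_power_series_bounds) (auto simp: harm_nonneg simp del: fact_Suc of_nat_Suc)
  moreover have "pser (\<lambda>n. - diffs cY n) z = - pser (diffs cY) z"
    by (simp add: pser_def suminf_minus[OF summable_diffs[OF summable_cY], symmetric])
  ultimately show ?thesis
    by (simp add: eval_nat_numeral harm_expand harm_Suc)
qed

lemma inverse_pi_bounds: "318 / 1000 \<le> 1 / pi" "1 / pi \<le> 319 / 1000"
  using pi_approx by (simp_all add: field_simps)

text \<open>At \<open>x = 2\<close> the series variable is \<open>z = 1\<close>, the right end of
  the range of the bounds above. Since \<open>bessel_J0'\<close> is negative there, the mixed term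
  calls for lower bounds of both moduli.\<close>

lemma energy_J0_2: "energy bessel_J0 bessel_J0' 2 \<le> 7 / 10"
proof -
  have J: "bessel_J0 2 = pser cJ 1" and J': "bessel_J0' 2 = pser (diffs cJ) 1"
    by (simp_all add: bessel_J0_pser bessel_J0'_def)
  have A: "pser cJ 1 \<in> {2 / 9..1 / 4}" using pser_cJ_bounds[of 1] by simp
  have A1: "- pser (diffs cJ) 1 \<in> {57 / 100..7 / 12}" using pser_diffs_cJ_bounds[of 1] by simp
  have "(pser cJ 1)\<^sup>2 \<le> (1 / 4)\<^sup>2" using A by (intro power_mono) auto
  moreover have "(pser (diffs cJ) 1)\<^sup>2 \<le> (7 / 12)\<^sup>2"
    using A1 power_mono[of "- pser (diffs cJ) 1" "7 / 12" 2] by simp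
  moreover have "(2 / 9) * (57 / 100) \<le> pser cJ 1 * - pser (diffs cJ) 1"
    using A A1 by (intro mult_mono) auto
  ultimately show ?thesis
    by (simp add: energy_def J J' power2_eq_square)
qed

text \<open>Besides giving \<open>z = 1\<close>, the choice \<open>x = 2\<close> makes the logarithm
  vanish, so only Euler's constant remains in front of the series.\<close>

lemma energy_Y0_2: "energy bessel_Y0 bessel_Y0' 2 \<le> 8 / 10"
proof -
  let ?g = "euler_mascheroni :: real"
  have Y: "bessel_Y0 2 = (2 / pi) * (?g * pser cJ 1 + - pser cY 1)"
    and Y': "bessel_Y0' 2 = (2 / pi) * (pser cJ 1 / 2 + ?g * pser (diffs cJ) 1 + - pser (diffs cY) 1)"
    by (simp_all add: bessel_Y0_pser bessel_Y0'_def)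
  have g: "0 < ?g" "?g \<in> {57 / 100..60 / 100}"
    using euler_mascheroni_gt_19_over_33 euler_mascheroni_less_13_over_22 by auto
  have A: "pser cJ 1 \<in> {2 / 9..1 / 4}" using pser_cJ_bounds[of 1] by simp
  have A1: "- pser (diffs cJ) 1 \<in> {57 / 100..7 / 12}" using pser_diffs_cJ_bounds[of 1] by simp
  have B: "- pser cY 1 \<in> {625 / 1000..676 / 1000}" using pser_cY_bounds[of 1] by simp
  have B1: "- pser (diffs cY) 1 \<in> {388 / 1000..403 / 1000}" using pser_diffs_cY_bounds[of 1] by simp
  have gA: "0 \<le> ?g * pser cJ 1" "?g * pser cJ 1 \<le> 60 / 100 * (1 / 4)"
    using A g mult_mono[of ?g "60 / 100" "pser cJ 1" "1 / 4"] by auto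
  have gA1: "57 / 100 * (57 / 100) \<le> ?g * - pser (diffs cJ) 1" "?g * - pser (diffs cJ) 1 \<le> 60 / 100 * (7 / 12)"
    using A1 g by (intro mult_mono; simp)+
  have p: "0 \<le> 2 / pi" "2 / pi \<le> 638 / 1000" using inverse_pi_bounds by simp_all
  have "bessel_Y0 2 \<le> 638 / 1000 * (826 / 1000)"
    unfolding Y using p gA B by (intro mult_mono) auto
  moreover have "0 \<le> bessel_Y0 2"
    unfolding Y using p gA B by (intro mult_nonneg_nonneg) auto
  ultimately have Y2: "0 \<le> bessel_Y0 2" "bessel_Y0 2 \<le> 53 / 100"
    by simp_all
  have "bessel_Y0' 2 \<le> 638 / 1000 * (204 / 1000)"
    unfolding Y' using p gA1 A B1 by (intro mult_mono) auto
  moreover have "0 \<le> bessel_Y0' 2"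
    unfolding Y' using p gA1 A B1 by (intro mult_nonneg_nonneg) auto
  ultimately have Y2': "0 \<le> bessel_Y0' 2" "bessel_Y0' 2 \<le> 14 / 100"
    by simp_all
  have "(bessel_Y0 2)\<^sup>2 \<le> (53 / 100)\<^sup>2" "(bessel_Y0' 2)\<^sup>2 \<le> (14 / 100)\<^sup>2"
    using Y2 Y2' by (auto intro!: power_mono)
  moreover have "bessel_Y0 2 * bessel_Y0' 2 \<le> (53 / 100) * (14 / 100)"
    using Y2 Y2' by (intro mult_mono) auto
  ultimately show ?thesis
    by (simp add: energy_def power2_eq_square)
qed

lemma norm_hankel_H0: "(norm (hankel_H0 x))\<^sup>2 = (bessel_J0 x)\<^sup>2 + (bessel_Y0 x)\<^sup>2"
  by (simp add: hankel_H0_def cmod_power2)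

text \<open>The constant is the sum of the energy bounds \<open>7 / 10\<close> and
  \<open>8 / 10\<close> at 2, carried to larger \<open>x\<close> by monotonicity.\<close>

lemma hankel_modulus_bound:
  assumes "2 \<le> x"
  shows "x * (norm (hankel_H0 x))\<^sup>2 \<le> 3 / 2"
proof -
  have "x * (bessel_J0 x)\<^sup>2 \<le> energy bessel_J0 bessel_J0' x"
    using assms by (intro energy_ge) simp
  also have "\<dots> \<le> energy bessel_J0 bessel_J0' 2"
    using assms by (intro energy_decreasing bessel_J0_deriv bessel_J0'_deriv) auto
  also note energy_J0_2
  finally have J: "x * (bessel_J0 x)\<^sup>2 \<le> 7 / 10" .
  have "x * (bessel_Y0 x)\<^sup>2 \<le> energy bessel_Y0 bessel_Y0' x"
    using assms by (intro energy_ge) simp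
  also have "\<dots> \<le> energy bessel_Y0 bessel_Y0' 2"
    using assms by (intro energy_decreasing bessel_Y0_deriv bessel_Y0'_deriv) auto
  also note energy_Y0_2
  finally show ?thesis using J by (simp add: norm_hankel_H0 distrib_left)
qed

section \<open>The cross product, bounded from above and from below\<close>

definition cross :: "real \<Rightarrow> real \<Rightarrow> real" where
  "cross x y = bessel_J0 y * bessel_Y0 x - bessel_J0 x * bessel_Y0 y"

lemma abs_cross_le: "\<bar>cross x y\<bar> \<le> norm (hankel_H0 x) * norm (hankel_H0 y)"
proof -
  have "cross x y = Im (hankel_H0 x * cnj (hankel_H0 y))"
    by (simp add: cross_def hankel_H0_def)
  also have "\<bar>\<dots>\<bar> \<le> norm (hankel_H0 x * cnj (hankel_H0 y))" by (rule abs_Im_le_cmod)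
  finally show ?thesis by (simp add: norm_mult)
qed

lemma sqrt_cross_le:
  assumes "2 \<le> x" "2 \<le> y"
  shows "sqrt (x * y) * \<bar>cross x y\<bar> \<le> 3 / 2"
proof (rule power2_le_imp_le)
  have "(sqrt (x * y) * \<bar>cross x y\<bar>)\<^sup>2 = x * y * \<bar>cross x y\<bar>\<^sup>2"
    using assms by (simp add: power_mult_distrib)
  also have "\<dots> \<le> x * y * (norm (hankel_H0 x) * norm (hankel_H0 y))\<^sup>2"
    using assms by (intro mult_left_mono power_mono abs_cross_le) auto
  also have "\<dots> = (x * (norm (hankel_H0 x))\<^sup>2) * (y * (norm (hankel_H0 y))\<^sup>2)"
    by (simp add: power_mult_distrib)
  also have "\<dots> \<le> (3 / 2) * (3 / 2)"
    using assms by (intro mult_mono hankel_modulus_bound) auto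
  finally show "(sqrt (x * y) * \<bar>cross x y\<bar>)\<^sup>2 \<le> (3 / 2)\<^sup>2" by (simp add: power2_eq_square)
qed simp

text \<open>\<open>2 / pi * sin (b - y)\<close> is the value at \<open>b\<close> of the solution of
  \<open>w'' = - w\<close> that shares its data at \<open>y\<close> with
  \<open>sqrt (t * y) * cross t y\<close>. The remaining term of the equation is controlled by
  \<open>sqrt_cross_le\<close>, whence \<open>3 / 8\<close>, which is \<open>1 / 4\<close> times
  \<open>3 / 2\<close>.\<close>

lemma cross_lower_bound:
  assumes "2 \<le> y" "y < b" "b - y \<le> pi / 2"
  shows "2 / pi * sin (b - y) - 3 / (8 * y\<^sup>2) * (b - y) \<le> sqrt (b * y) * cross b y"
proof -
  define K where "K = (\<lambda>t. cross t y)"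
  define K' where "K' = (\<lambda>t. bessel_J0 y * bessel_Y0' t - bessel_J0' t * bessel_Y0 y)"
  have K: "(K has_real_derivative K' t) (at t)" if "t > 0" for t
    unfolding K_def K'_def cross_def
    by (intro DERIV_diff DERIV_cmult DERIV_cmult_right bessel_J0_deriv bessel_Y0_deriv that)
  have K': "(K' has_real_derivative - K' t / t - K t) (at t)" if "t > 0" for t
    unfolding K'_def
    by (rule DERIV_cong[OF DERIV_diff[OF DERIV_cmult[OF bessel_Y0'_deriv[OF that]]
           DERIV_cmult_right[OF bessel_J0'_deriv[OF that]]]])
      (use that in \<open>simp add: K_def cross_def field_simps\<close>)
  define w where "w = (\<lambda>t. sqrt t * K t)"
  define w1 where "w1 = (\<lambda>t. sqrt t * K' t + 1 / 2 * (K t / sqrt t))"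
  have s: "(sqrt has_real_derivative inverse (sqrt t) / 2) (at t)" if "t > 0" for t
    using DERIV_real_sqrt[OF that] by (simp add: field_simps)
  have w: "(w has_real_derivative w1 t) (at t)" if "t > 0" for t
    unfolding w_def
    by (rule DERIV_cong[OF DERIV_mult[OF s[OF that] K[OF that]]])
      (simp add: w1_def field_simps)
  have w1: "(w1 has_real_derivative - (1 + 1 / (4 * t\<^sup>2)) * w t) (at t)" if "t > 0" for t
  proof -
    have nz: "sqrt t \<noteq> 0" using that by simp
    have sq: "t = sqrt t * sqrt t" using that by simp
    have "r \<noteq> 0 \<Longrightarrow> inverse r / 2 * D + (- D / (r * r) - C) * r
        + 1 / 2 * ((D * r - C * (inverse r / 2)) / (r * r))
        = - (1 + 1 / (4 * (r * r)\<^sup>2)) * (r * C)" for r C D :: real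
      by (simp add: field_simps power2_eq_square)
    from this[OF nz, of "K' t" "K t", folded sq] show ?thesis
      unfolding w1_def
      by (intro DERIV_cong[OF DERIV_add[OF DERIV_mult[OF s[OF that] K'[OF that]]
             DERIV_cmult[OF DERIV_divide[OF K[OF that] s[OF that] nz]]]])
        (use that in \<open>simp add: w_def\<close>)
  qed
  \<comment> \<open>For \<open>w'' = -w\<close> this would be constant, so \<open>w b = P b\<close> differs from \<open>P y\<close> only by the \<open>1 / (4 t\<^sup>2)\<close> term.\<close>
  define P where "P = (\<lambda>t. w1 t * sin (b - t) + w t * cos (b - t))"
  have P: "(P has_real_derivative - (1 / (4 * t\<^sup>2)) * w t * sin (b - t)) (at t)" if "t > 0" for t
  proof -
    have "((\<lambda>t. sin (b - t)) has_real_derivative - cos (b - t)) (at t)"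
      "((\<lambda>t. cos (b - t)) has_real_derivative sin (b - t)) (at t)"
      by (auto intro!: derivative_eq_intros)
    from DERIV_add[OF DERIV_mult[OF w1[OF that] this(1)] DERIV_mult[OF w[OF that] this(2)]]
    show ?thesis unfolding P_def
      by (rule DERIV_cong) (simp add: algebra_simps)
  qed
  \<comment> \<open>The mean value theorem stands in for integrating the derivative of
    \<open>P\<close>; a bound at one intermediate point is enough.\<close>
  obtain \<xi> where \<xi>: "y < \<xi>" "\<xi> < b"
    and mvt: "P b - P y = (b - y) * (- (1 / (4 * \<xi>\<^sup>2)) * w \<xi> * sin (b - \<xi>))"
    using MVT2[of y b P "\<lambda>t. - (1 / (4 * t\<^sup>2)) * w t * sin (b - t)"] P assms by force
  \<comment> \<open>Initial data at \<open>y\<close>: the cross product vanishes there and its slope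
    is the Wronskian.\<close>
  have "K y = 0" by (simp add: K_def cross_def)
  moreover have "K' y = 2 / (pi * y)"
    using bessel_wronskian[of y] assms by (simp add: K'_def)
  ultimately have "sqrt y * P y = 2 / pi * sin (b - y)"
    using assms by (simp add: P_def w_def w1_def field_simps)
  moreover have "sqrt y * P b = sqrt (b * y) * cross b y"
    by (simp add: P_def w_def K_def real_sqrt_mult)
  moreover have "\<bar>sqrt y * (P b - P y)\<bar> \<le> (b - y) * (1 / (4 * y\<^sup>2)) * (3 / 2) * 1"
  proof -
    have "\<bar>sqrt y * (P b - P y)\<bar> = (b - y) * (1 / (4 * \<xi>\<^sup>2)) * (sqrt (\<xi> * y) * \<bar>cross \<xi> y\<bar>) * \<bar>sin (b - \<xi>)\<bar>"
      unfolding mvt using assms \<xi> by (simp add: abs_mult w_def K_def real_sqrt_mult)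
    also have "\<dots> \<le> (b - y) * (1 / (4 * y\<^sup>2)) * (3 / 2) * 1"
      using assms \<xi> by (intro mult_mono sqrt_cross_le frac_le) auto
    finally show ?thesis .
  qed
  ultimately show ?thesis by (simp add: algebra_simps)
qed

section \<open>Estimates on the arc\<close>

lemma pi_upper: "pi \<le> 3142 / 1000"
  using pi_approx(2) by simp

lemma cos_ge_quadratic: "1 - x\<^sup>2 / 2 \<le> cos (x::real)"
proof -
  have "(sin (x / 2))\<^sup>2 \<le> (x / 2)\<^sup>2"
    using abs_sin_x_le_abs_x[of "x / 2"] by (simp only: abs_le_square_iff)
  then show ?thesis
    using cos_double_sin[of "x / 2"] by (simp add: power_divide)
qed

text \<open>\<open>B\<close> and \<open>B'\<close> are meant as bounds of the Hankel moduli at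
  \<open>x\<close> and \<open>y\<close> over the whole arc. After multiplication by
  \<open>sqrt (x * y)\<close> the left-hand side is at most \<open>33 / 10\<close>, while
  \<open>cross x y\<close> becomes at least \<open>56 / 100\<close>, and 7 times that is
  larger.\<close>

lemma cross_dominates_far:
  assumes "39 / 5 \<le> y" "y < x" "x - y \<le> pi / 2" "pi / 2 - 41 / 100 \<le> x - y"
    and "0 \<le> B" "x * B\<^sup>2 \<le> 9 / 5" "0 \<le> B'" "y * B'\<^sup>2 \<le> 9 / 5"
  shows "B * norm (hankel_H0 y) + B' * norm (hankel_H0 x) \<le> 7 * cross x y \<and> 0 < cross x y"
proof -
  let ?s = "sqrt (x * y)"
  have s: "0 < ?s" using assms by simp
  \<comment> \<open>The square splits into \<open>9 / 5\<close> from the hypothesis and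
    \<open>3 / 2\<close> from the modulus bound; \<open>165 / 100\<close> lies just above the root
    of \<open>27 / 10\<close>.\<close>
  have factor: "?s * (b * norm (hankel_H0 v)) \<le> 165 / 100"
    if "u * b\<^sup>2 \<le> 9 / 5" "u * v = x * y" "2 \<le> v" "0 \<le> u" for u v b
  proof (rule power2_le_imp_le)
    have "(?s * (b * norm (hankel_H0 v)))\<^sup>2 = (u * b\<^sup>2) * (v * (norm (hankel_H0 v))\<^sup>2)"
    proof -
      have "?s\<^sup>2 = u * v" using assms that(2) by simp
      then show ?thesis by (simp add: power_mult_distrib)
    qed
    also have "\<dots> \<le> 9 / 5 * (3 / 2)"
      using that by (intro mult_mono hankel_modulus_bound) auto
    also have "\<dots> \<le> (165 / 100)\<^sup>2" by (simp add: power2_eq_square)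
    finally show "(?s * (b * norm (hankel_H0 v)))\<^sup>2 \<le> (165 / 100)\<^sup>2" .
  qed simp
  have upper: "?s * (B * norm (hankel_H0 y) + B' * norm (hankel_H0 x)) \<le> 33 / 10"
    using factor[of x B y] factor[of y B' x] assms unfolding distrib_left by (simp add: mult.commute)
  have "(pi / 2 - (x - y))\<^sup>2 \<le> (41 / 100)\<^sup>2" using assms by (intro power_mono) auto
  then have "915 / 1000 \<le> cos (pi / 2 - (x - y))"
    using cos_ge_quadratic[of "pi / 2 - (x - y)"] by (simp add: power2_eq_square)
  also have "\<dots> = sin (x - y)" by (simp add: cos_diff)
  finally have "636 / 1000 * (915 / 1000) \<le> 2 / pi * sin (x - y)"
    using inverse_pi_bounds by (intro mult_mono) auto
  moreover have "3 / (8 * y\<^sup>2) * (x - y) \<le> 13 / 1000"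
  proof -
    have "3 / (8 * y\<^sup>2) * (x - y) \<le> 3 / (8 * (39 / 5)\<^sup>2) * 2"
      using assms pi_half_less_two by (intro mult_mono frac_le power_mono) auto
    also have "\<dots> \<le> 13 / 1000" by (simp add: power2_eq_square)
    finally show ?thesis .
  qed
  moreover have "2 / pi * sin (x - y) - 3 / (8 * y\<^sup>2) * (x - y) \<le> ?s * cross x y"
    using assms by (intro cross_lower_bound) auto
  ultimately have lower: "56 / 100 \<le> ?s * cross x y" by linarith
  then have "0 < ?s * cross x y" by linarith
  then have "0 < cross x y" using s by (rule zero_less_mult_pos)
  moreover have "?s * (B * norm (hankel_H0 y) + B' * norm (hankel_H0 x)) \<le> ?s * (7 * cross x y)"
    using upper lower by linarith
  then have "B * norm (hankel_H0 y) + B' * norm (hankel_H0 x) \<le> 7 * cross x y"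
    using s by (rule mult_left_le_imp_le)
  ultimately show ?thesis by simp
qed

lemma norm_hankel_H0_le:
  assumes "2 \<le> \<mu>" "\<mu> \<le> x"
  shows "norm (hankel_H0 x) \<le> sqrt (3 / 2 / \<mu>)"
proof (rule real_le_rsqrt)
  have "\<mu> * (norm (hankel_H0 x))\<^sup>2 \<le> x * (norm (hankel_H0 x))\<^sup>2"
    using assms by (intro mult_right_mono) auto
  also have "\<dots> \<le> 3 / 2" using assms by (intro hankel_modulus_bound) auto
  finally show "(norm (hankel_H0 x))\<^sup>2 \<le> 3 / 2 / \<mu>"
    using assms by (simp add: field_simps)
qed

text \<open>Here \<open>\<kappa>\<close> is \<open>k * R\<close> and \<open>c\<close> the cosine of
  the angle from the middle of the arc, so \<open>x\<close> and \<open>y\<close> come from the law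
  of cosines. At \<open>c = 1\<close> the points are collinear and \<open>x - y\<close> is exactly
  \<open>pi / 2\<close>; the shortness of the arc keeps it close to that. \<open>B\<close> and
  \<open>B'\<close> belong to the smallest arguments, attained at \<open>c = 1\<close>.\<close>

lemma arc_estimate_far:
  fixes \<kappa> c x y :: real
  defines "d \<equiv> pi / (2 * \<kappa>)"
  assumes \<kappa>: "6 * pi \<le> \<kappa>" and c: "95 / 100 \<le> c" "c \<le> 1" and pos: "0 \<le> x" "0 \<le> y"
    and x: "x\<^sup>2 = \<kappa>\<^sup>2 * (1 + (1 / 2)\<^sup>2 - 2 * (1 / 2) * c)"
    and y: "y\<^sup>2 = \<kappa>\<^sup>2 * (1 + (1 / 2 + d)\<^sup>2 - 2 * (1 / 2 + d) * c)"
  defines "B \<equiv> sqrt (3 / 2 / (\<kappa> / 2))" and "B' \<equiv> sqrt (3 / 2 / (\<kappa> / 2 - pi / 2))"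
  shows "0 < x \<and> 0 < y \<and> norm (hankel_H0 x) \<le> B \<and> norm (hankel_H0 y) \<le> B' \<and>
    B * norm (hankel_H0 y) + B' * norm (hankel_H0 x) \<le> 7 * \<bar>cross x y\<bar> \<and> cross x y \<noteq> 0"
proof -
  have \<kappa>0: "\<kappa> > 0" using \<kappa> pi_gt_zero by linarith
  have \<kappa>d: "\<kappa> * d = pi / 2" using \<kappa>0 by (simp add: d_def)
  have d: "0 \<le> d" "d \<le> 1 / 12" using \<kappa> \<kappa>0 by (simp_all add: d_def field_simps)
  have dc: "d * (95 / 100) \<le> d * c" "d * c \<le> d * 1" using d c by (intro mult_left_mono; simp)+
  have dd: "d * d \<le> d * (1 / 12)" "0 \<le> d * d" using d by (intro mult_left_mono) auto
  have half: "\<kappa> / 2 - pi / 2 = \<kappa> * (1 / 2 - d)" using \<kappa>d by (simp add: algebra_simps)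
  have le: "u \<le> \<kappa> * r" if "0 \<le> r" "u\<^sup>2 = \<kappa>\<^sup>2 * v" "v \<le> r\<^sup>2" for u v r
  proof (rule power2_le_imp_le)
    show "u\<^sup>2 \<le> (\<kappa> * r)\<^sup>2"
      unfolding that(2) power_mult_distrib using that(3) by (rule mult_left_mono) simp
  qed (use that \<kappa>0 in simp)
  have ge: "\<kappa> * r \<le> u" if "0 \<le> u" "u\<^sup>2 = \<kappa>\<^sup>2 * v" "r\<^sup>2 \<le> v" for u v r
  proof (rule power2_le_imp_le)
    show "(\<kappa> * r)\<^sup>2 \<le> u\<^sup>2"
      unfolding that(2) power_mult_distrib using that(3) by (rule mult_left_mono) simp
  qed (rule that)
  have vx: "1 + (1 / 2)\<^sup>2 - 2 * (1 / 2) * c = 5 / 4 - c" by (simp add: power2_eq_square)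
  have vy: "1 + (1 / 2 + d)\<^sup>2 - 2 * (1 / 2 + d) * c = 5 / 4 + d + d * d - c - 2 * (d * c)"
    by (simp add: power2_eq_square algebra_simps)
  have r: "(1 / 2)\<^sup>2 = (1 / 4 :: real)" "(55 / 100)\<^sup>2 = (3025 / 10000 :: real)"
    "(1 / 2 - d)\<^sup>2 = 1 / 4 - d + d * d" "(6 / 5 * (1 / 2 - d))\<^sup>2 = 36 / 100 - 36 / 25 * d + 36 / 25 * (d * d)"
    by (simp_all add: power2_eq_square field_simps)
  have x_ge: "\<kappa> * (1 / 2) \<le> x" by (rule ge[OF pos(1) x]) (unfold vx r, use c in linarith)
  have x_le: "x \<le> \<kappa> * (55 / 100)"
    by (rule le[OF _ x]) (simp, unfold vx r, use c in linarith)
  have y_ge: "\<kappa> * (1 / 2 - d) \<le> y"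
    by (rule ge[OF pos(2) y]) (unfold vy r, use c dc in linarith)
  have y_le: "y \<le> \<kappa> * (55 / 100)"
    by (rule le[OF _ y]) (simp, unfold vy r, use c dc dd d in linarith)
  \<comment> \<open>The factor \<open>6 / 5\<close> turns the \<open>3 / 2\<close> inside
    \<open>B'\<close> into the \<open>9 / 5\<close> required by
    \<open>cross_dominates_far\<close>.\<close>
  have y_le': "y \<le> \<kappa> * (6 / 5 * (1 / 2 - d))"
    by (rule le[OF _ y]) (use d in simp, unfold vy r, use c dc dd d in linarith)
  have y8: "39 / 5 \<le> \<kappa> / 2 - pi / 2" using \<kappa> pi_approx by simp
  then have y0: "39 / 5 \<le> y" using y_ge half by linarith
  \<comment> \<open>The squares are explicit, so \<open>x - y\<close> is estimated through its
    product with \<open>x + y\<close>.\<close>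
  have diff: "(x - y) * (x + y) = \<kappa> * (pi / 2) * (2 * c - 1 - d)"
  proof -
    have "(x - y) * (x + y) = x\<^sup>2 - y\<^sup>2" by (simp add: power2_eq_square algebra_simps)
    also have "\<dots> = \<kappa> * (\<kappa> * d) * (2 * c - 1 - d)"
      unfolding x y by (simp add: power2_eq_square algebra_simps)
    finally show ?thesis by (simp only: \<kappa>d)
  qed
  have xy: "0 < x + y" using x_ge y0 \<kappa>0 by simp
  have T_le: "x - y \<le> pi / 2"
  proof (rule mult_right_le_imp_le[OF _ xy])
    have "\<kappa> * (2 * c - 1 - d) \<le> \<kappa> * (1 - d)" using c \<kappa>0 by (intro mult_left_mono) auto
    also have "\<dots> \<le> x + y" using x_ge y_ge by (simp add: algebra_simps)
    finally have "pi / 2 * (\<kappa> * (2 * c - 1 - d)) \<le> pi / 2 * (x + y)" by (intro mult_left_mono) auto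
    then show "(x - y) * (x + y) \<le> pi / 2 * (x + y)" unfolding diff by (simp add: ac_simps)
  qed
  \<comment> \<open>\<open>814 / 1000\<close> is \<open>74 / 100\<close> times
    \<open>110 / 100\<close> and lies below \<open>9 / 10 - 1 / 12\<close>. The deficit of 26
    percent of \<open>pi / 2\<close> stays below the permitted \<open>41 / 100\<close>.\<close>
  have T_ge: "pi / 2 * (74 / 100) \<le> x - y"
  proof (rule mult_right_le_imp_le[OF _ xy])
    have "74 / 100 * (x + y) \<le> \<kappa> * (814 / 1000)" using x_le y_le by simp
    also have "\<dots> \<le> \<kappa> * (2 * c - 1 - d)" using c d \<kappa>0 by (intro mult_left_mono) auto
    finally have "pi / 2 * (74 / 100 * (x + y)) \<le> pi / 2 * (\<kappa> * (2 * c - 1 - d))"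
      by (intro mult_left_mono) auto
    then show "pi / 2 * (74 / 100) * (x + y) \<le> (x - y) * (x + y)"
      unfolding diff by (simp add: ac_simps)
  qed
  have "x * B\<^sup>2 \<le> 9 / 5"
  proof -
    have "B\<^sup>2 = 3 / \<kappa>" using \<kappa>0 by (simp add: B_def)
    moreover have "x * (3 / \<kappa>) \<le> \<kappa> * (55 / 100) * (3 / \<kappa>)"
      using x_le \<kappa>0 by (intro mult_right_mono) auto
    ultimately show ?thesis using \<kappa>0 by simp
  qed
  moreover have "y * B'\<^sup>2 \<le> 9 / 5"
  proof -
    let ?\<mu> = "\<kappa> / 2 - pi / 2"
    have "B'\<^sup>2 = 3 / 2 / ?\<mu>" unfolding B'_def using y8 by (intro real_sqrt_pow2) simp
    moreover have "y * (3 / 2 / ?\<mu>) \<le> 6 / 5 * ?\<mu> * (3 / 2 / ?\<mu>)"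
    proof (rule mult_right_mono)
      show "y \<le> 6 / 5 * ?\<mu>" using y_le' unfolding half by (simp only: mult.left_commute)
      show "0 \<le> 3 / 2 / ?\<mu>" using y8 by simp
    qed
    moreover have "6 / 5 * ?\<mu> * (3 / 2 / ?\<mu>) = 9 / 5"
    proof -
      have "t \<noteq> 0 \<Longrightarrow> 6 / 5 * t * (3 / 2 / t) = 9 / 5" for t :: real by simp
      then show ?thesis by this (use y8 in linarith)
    qed
    ultimately show ?thesis by (simp only:)
  qed
  moreover have "0 \<le> B" "0 \<le> B'" using \<kappa>0 y8 by (simp_all add: B_def B'_def)
  moreover have "y < x" "pi / 2 - 41 / 100 \<le> x - y" using T_ge pi_gt_zero pi_upper by linarith+
  ultimately have
    "B * norm (hankel_H0 y) + B' * norm (hankel_H0 x) \<le> 7 * cross x y \<and> 0 < cross x y"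
    using y0 T_le by (intro cross_dominates_far)
  moreover have "norm (hankel_H0 x) \<le> B"
    unfolding B_def using x_ge \<kappa> pi_gt3 by (intro norm_hankel_H0_le; linarith)
  moreover have "norm (hankel_H0 y) \<le> B'"
    unfolding B'_def using y_ge y8 half by (intro norm_hankel_H0_le; linarith)
  moreover have "0 < x" "0 < y" using x_ge \<kappa>0 y0 by linarith+
  ultimately show ?thesis by simp
qed

section \<open>Small arguments: the wavenumber \<open>k_star\<close>\<close>

lemma ln_half: "0 < (x::real) \<Longrightarrow> ln (x / 2) = ln ((x / 2)\<^sup>2) / 2"
  by (subst ln_realpow) auto

lemma euler_mascheroni_bounds_decimal:
  "(euler_mascheroni :: real) \<in> {575 / 1000..592 / 1000}"
  using euler_mascheroni_gt_19_over_33 euler_mascheroni_less_13_over_22 by auto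

text \<open>The limits for \<open>(x / 2)\<^sup>2\<close> are powers of 2, so the logarithm reduces
  to multiples of \<open>ln 2\<close>.\<close>

lemma bessel_bounds_near_third:
  assumes "0 < x" "1 / 64 \<le> (x / 2)\<^sup>2" "(x / 2)\<^sup>2 \<le> 1 / 32"
  shows "bessel_J0 x \<in> {96 / 100..1}" "bessel_Y0 x \<in> {- 1..- 6 / 10}"
proof -
  define z where "z = (x / 2)\<^sup>2"
  have z: "1 / 64 \<le> z" "z \<le> 1 / 32" using assms by (simp_all add: z_def)
  then have z01: "0 \<le> z" "z \<le> 1" by simp_all
  have zz: "z\<^sup>2 \<le> z * (1 / 32)" "0 \<le> z\<^sup>2" using z by (auto simp: power2_eq_square intro!: mult_left_mono)
  have zzz: "z ^ 3 \<le> z\<^sup>2" "0 \<le> z ^ 3" using z by (auto intro!: power_decreasing)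
  have A: "pser cJ z \<in> {96 / 100..1}"
    using pser_cJ_bounds[OF z01] z zz zzz unfolding atLeastAtMost_iff by linarith
  then show "bessel_J0 x \<in> {96 / 100..1}" by (simp add: bessel_J0_pser z_def)
  have B: "- pser cY z \<in> {0..4 / 100}"
    using pser_cY_bounds[OF z01] z zz zzz unfolding atLeastAtMost_iff by linarith
  have "ln (1 / 64 :: real) \<le> ln z" "ln z \<le> ln (1 / 32)" using z by simp_all
  moreover have "ln (1 / 64 :: real) = - 6 * ln 2" "ln (1 / 32 :: real) = - 5 * ln 2"
    using ln_realpow[of "2::real" 6] ln_realpow[of "2::real" 5] by (simp_all add: ln_div)
  ultimately have "ln (x / 2) \<in> {- 3 * ln 2..- 5 / 2 * ln 2}"
    using ln_half[OF assms(1), folded z_def] unfolding atLeastAtMost_iff by linarith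
  then have L: "- (ln (x / 2) + euler_mascheroni) \<in> {107 / 100..151 / 100}"
    using euler_mascheroni_bounds_decimal ln2_ge_two_thirds ln2_le_25_over_36
    unfolding atLeastAtMost_iff by linarith
  then have "107 / 100 * (96 / 100) \<le> - (ln (x / 2) + euler_mascheroni) * pser cJ z"
    "- (ln (x / 2) + euler_mascheroni) * pser cJ z \<le> 151 / 100 * 1"
    using A unfolding atLeastAtMost_iff by (intro mult_mono; linarith)+
  then have W: "- ((ln (x / 2) + euler_mascheroni) * pser cJ z - pser cY z) \<in> {98 / 100..151 / 100}"
    using B unfolding atLeastAtMost_iff minus_mult_left by linarith
  have "636 / 1000 * (98 / 100) \<le> 2 / pi * - ((ln (x / 2) + euler_mascheroni) * pser cJ z - pser cY z)"
    "2 / pi * - ((ln (x / 2) + euler_mascheroni) * pser cJ z - pser cY z) \<le> 638 / 1000 * (151 / 100)"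
    using W inverse_pi_bounds pi_gt_zero unfolding atLeastAtMost_iff by (intro mult_mono; linarith?; simp)+
  then show "bessel_Y0 x \<in> {- 1..- 6 / 10}"
    unfolding bessel_Y0_pser z_def[symmetric] mult_minus_right atLeastAtMost_iff by linarith
qed

text \<open>Here \<open>z = (x / 2)\<^sup>2\<close> is near enough to 1 for the elementary bounds
  \<open>1 - 1 / z \<le> ln z\<close> and \<open>ln z \<le> z - 1\<close>.\<close>

lemma bessel_bounds_near_half_pi:
  assumes "0 < x" "600 / 1000 \<le> (x / 2)\<^sup>2" "(x / 2)\<^sup>2 \<le> 618 / 1000"
  shows "bessel_J0 x \<in> {45 / 100..1 / 2}" "bessel_Y0 x \<in> {3 / 10..1 / 2}"
proof -
  define z where "z = (x / 2)\<^sup>2"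
  have z: "600 / 1000 \<le> z" "z \<le> 618 / 1000" using assms by (simp_all add: z_def)
  then have z01: "0 \<le> z" "z \<le> 1" by simp_all
  have zz: "(600 / 1000)\<^sup>2 \<le> z\<^sup>2" "z\<^sup>2 \<le> (618 / 1000)\<^sup>2" using z by (auto intro!: power_mono)
  have zzz: "z ^ 3 \<le> (618 / 1000) ^ 3" "0 \<le> z ^ 3" using z by (auto intro!: power_mono)
  note zs = z zz[unfolded power2_eq_square[of "_ / _"]] zzz[unfolded power3_eq_cube[of "_ / _"]]
  have A: "pser cJ z \<in> {46 / 100..1 / 2}"
    using pser_cJ_bounds[OF z01] zs unfolding atLeastAtMost_iff by linarith
  then show "bessel_J0 x \<in> {45 / 100..1 / 2}" by (simp add: bessel_J0_pser z_def)
  have B: "- pser cY z \<in> {45 / 100..1 / 2}"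
    using pser_cY_bounds[OF z01] zs unfolding atLeastAtMost_iff by linarith
  have "ln z \<le> z - 1" using z by (intro ln_le_minus_one) simp
  moreover have "1 - 1 / z \<le> ln z"
    using ln_le_minus_one[of "1 / z"] z by (simp add: ln_div)
  moreover have "1 / z \<le> 5 / 3" using z by (simp add: field_simps)
  ultimately have "ln (x / 2) \<in> {- 34 / 100..- 19 / 100}"
    using ln_half[OF assms(1), folded z_def] z unfolding atLeastAtMost_iff by linarith
  then have L: "ln (x / 2) + euler_mascheroni \<in> {23 / 100..41 / 100}"
    using euler_mascheroni_bounds_decimal unfolding atLeastAtMost_iff by linarith
  then have "23 / 100 * (46 / 100) \<le> (ln (x / 2) + euler_mascheroni) * pser cJ z"
    "(ln (x / 2) + euler_mascheroni) * pser cJ z \<le> 41 / 100 * (1 / 2)"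
    using A unfolding atLeastAtMost_iff by (intro mult_mono; linarith)+
  then have W: "(ln (x / 2) + euler_mascheroni) * pser cJ z - pser cY z \<in> {55 / 100..71 / 100}"
    using B unfolding atLeastAtMost_iff minus_mult_left by linarith
  have "636 / 1000 * (55 / 100) \<le> 2 / pi * ((ln (x / 2) + euler_mascheroni) * pser cJ z - pser cY z)"
    "2 / pi * ((ln (x / 2) + euler_mascheroni) * pser cJ z - pser cY z) \<le> 638 / 1000 * (71 / 100)"
    using W inverse_pi_bounds pi_gt_zero unfolding atLeastAtMost_iff by (intro mult_mono; linarith?; simp)+
  then show "bessel_Y0 x \<in> {3 / 10..1 / 2}"
    unfolding bessel_Y0_pser z_def[symmetric] atLeastAtMost_iff by linarith
qed

text \<open>Now \<open>k * R\<close> is \<open>pi / 5\<close>, and the factor \<open>- 3 / 2\<close>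
  puts the second source on the far side of the origin: \<open>x\<close> is near
  \<open>pi / 10\<close>, where \<open>bessel_Y0\<close> is negative, and \<open>y\<close> near
  \<open>pi / 2\<close>, where it is positive. The two terms of \<open>cross x y\<close> then have
  the same sign and cannot cancel.\<close>

lemma arc_estimate_near:
  fixes c x y :: real
  assumes c: "95 / 100 \<le> c" "c \<le> 1" and pos: "0 \<le> x" "0 \<le> y"
    and x: "x\<^sup>2 = (pi / 5)\<^sup>2 * (1 + (1 / 2)\<^sup>2 - 2 * (1 / 2) * c)"
    and y: "y\<^sup>2 = (pi / 5)\<^sup>2 * (1 + (- 3 / 2)\<^sup>2 - 2 * (- 3 / 2) * c)"
  shows "0 < x \<and> 0 < y \<and> norm (hankel_H0 x) \<le> 142 / 100 \<and> norm (hankel_H0 y) \<le> 71 / 100 \<and>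
    142 / 100 * norm (hankel_H0 y) + 71 / 100 * norm (hankel_H0 x) \<le> 7 * \<bar>cross x y\<bar> \<and> cross x y \<noteq> 0"
proof -
  define p where "p = (pi / 5)\<^sup>2"
  have "(6283 / 10000)\<^sup>2 \<le> p" "p \<le> (62832 / 100000)\<^sup>2"
    unfolding p_def using pi_approx by (intro power_mono; simp)+
  then have p: "3947 / 10000 \<le> p" "p \<le> 3949 / 10000" by (simp_all add: power2_eq_square)
  have "3947 / 10000 * (1 / 4) \<le> p * (5 / 4 - c)" "p * (5 / 4 - c) \<le> 3949 / 10000 * (3 / 10)"
    using p c by (intro mult_mono; linarith)+
  moreover have "(x / 2)\<^sup>2 = p * (5 / 4 - c) / 4"
    unfolding power_divide x p_def by (simp add: power2_eq_square)
  ultimately have x4: "1 / 64 \<le> (x / 2)\<^sup>2" "(x / 2)\<^sup>2 \<le> 1 / 32" by linarith+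
  have "3947 / 10000 * (61 / 10) \<le> p * (13 / 4 + 3 * c)" "p * (13 / 4 + 3 * c) \<le> 3949 / 10000 * (25 / 4)"
    using p c by (intro mult_mono; linarith)+
  moreover have "(y / 2)\<^sup>2 = p * (13 / 4 + 3 * c) / 4"
    unfolding power_divide y p_def by (simp add: power2_eq_square)
  ultimately have y4: "600 / 1000 \<le> (y / 2)\<^sup>2" "(y / 2)\<^sup>2 \<le> 618 / 1000" by linarith+
  have x0: "0 < x" using x4(1) pos(1) by (cases "x = 0") auto
  have y0: "0 < y" using y4(1) pos(2) by (cases "y = 0") auto
  note bx = bessel_bounds_near_third[OF x0 x4, unfolded atLeastAtMost_iff]
    and by' = bessel_bounds_near_half_pi[OF y0 y4, unfolded atLeastAtMost_iff]
  have sq_le: "t\<^sup>2 \<le> r\<^sup>2" if "- r \<le> t" "t \<le> r" for t r :: real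
    using that by (intro abs_le_square_iff[THEN iffD1]) linarith
  have "(bessel_J0 x)\<^sup>2 \<le> 1\<^sup>2" "(bessel_Y0 x)\<^sup>2 \<le> 1\<^sup>2"
    using bx by (intro sq_le; linarith)+
  then have "(norm (hankel_H0 x))\<^sup>2 \<le> (142 / 100)\<^sup>2"
    unfolding norm_hankel_H0 by (simp add: power2_eq_square)
  then have hx: "norm (hankel_H0 x) \<le> 142 / 100" by (rule power2_le_imp_le) simp
  have "(bessel_J0 y)\<^sup>2 \<le> (1 / 2)\<^sup>2" "(bessel_Y0 y)\<^sup>2 \<le> (1 / 2)\<^sup>2"
    using by' by (intro sq_le; linarith)+
  then have "(norm (hankel_H0 y))\<^sup>2 \<le> (71 / 100)\<^sup>2"
    unfolding norm_hankel_H0 by (simp add: power2_eq_square)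
  then have hy: "norm (hankel_H0 y) \<le> 71 / 100" by (rule power2_le_imp_le) simp
  have "45 / 100 * (6 / 10) \<le> bessel_J0 y * - bessel_Y0 x"
    "96 / 100 * (3 / 10) \<le> bessel_J0 x * bessel_Y0 y"
    using bx by' by (intro mult_mono; linarith)+
  then have cr: "1 / 2 \<le> - cross x y" unfolding cross_def mult_minus_right by linarith
  then have "142 / 100 * norm (hankel_H0 y) + 71 / 100 * norm (hankel_H0 x) \<le> 7 * \<bar>cross x y\<bar>"
    using hx hy by linarith
  moreover have "cross x y \<noteq> 0" using cr by auto
  ultimately show ?thesis using hx hy x0 y0 by blast
qed

section \<open>Geometry of the arc, and both cases in one statement\<close>

lemma norm_polar_diff:
  assumes "0 \<le> R"
  shows "(norm (polar R \<theta> - polar (l * R) \<phi>))\<^sup>2 = R\<^sup>2 * (1 + l\<^sup>2 - 2 * l * cos (\<theta> - \<phi>))"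
proof -
  have "(norm (polar R \<theta> - polar (l * R) \<phi>))\<^sup>2
      = R\<^sup>2 * (((cos \<theta>)\<^sup>2 + (sin \<theta>)\<^sup>2) + l\<^sup>2 * ((cos \<phi>)\<^sup>2 + (sin \<phi>)\<^sup>2)
         - 2 * l * (cos \<theta> * cos \<phi> + sin \<theta> * sin \<phi>))"
    unfolding power2_norm_eq_inner
    by (simp add: polar_def inner_vec_def sum_2 power2_eq_square algebra_simps del: sin_cos_squared_add3)
  then show ?thesis by (simp add: cos_diff)
qed

text \<open>A nonzero integer vector has Euclidean norm at least 1. Together with
  \<open>\<tau> \<ge> 6\<close> this will give \<open>k * R \<ge> 6 * pi\<close>.\<close>

lemma wavenumber_ge:
  assumes "k \<in> wavenumbers a N" "k \<noteq> k_star a" "a > 0"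
  shows "pi / a \<le> k"
proof -
  obtain l1 l2 :: int where k: "k = pi / a * sqrt ((real_of_int l1)\<^sup>2 + (real_of_int l2)\<^sup>2)"
    and "1 \<le> max \<bar>l1\<bar> \<bar>l2\<bar>"
    using assms by (auto simp: wavenumbers_def)
  then have "1 \<le> \<bar>l1\<bar> \<or> 1 \<le> \<bar>l2\<bar>" by (simp only: le_max_iff_disj)
  moreover have "1 \<le> (real_of_int l)\<^sup>2" if "1 \<le> \<bar>l\<bar>" for l
  proof -
    have "\<bar>1\<bar> \<le> \<bar>real_of_int l\<bar>" using that by linarith
    then show ?thesis unfolding abs_le_square_iff by simp
  qed
  ultimately have "1 \<le> (real_of_int l1)\<^sup>2 \<or> 1 \<le> (real_of_int l2)\<^sup>2" by blast
  then have "1 \<le> (real_of_int l1)\<^sup>2 + (real_of_int l2)\<^sup>2"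
    using zero_le_power2[of "real_of_int l1"] zero_le_power2[of "real_of_int l2"] by linarith
  then have "pi / a * 1 \<le> k"
    unfolding k using assms(3) by (intro mult_left_mono) auto
  then show ?thesis by simp
qed

text \<open>\<open>B1\<close> and \<open>B2\<close> are fixed before the point \<open>x\<close>: the
  amplitudes of the reference sources involve suprema of \<open>Phi\<close> over the arc, so the
  cross product has to dominate uniform bounds and not only pointwise moduli.\<close>

lemma arc_estimate:
  fixes j :: nat
  assumes "a > 0" "m \<ge> 10" "\<tau> \<ge> 6" "k \<in> wavenumbers a N"
    and R: "R = (if k = k_star a then 6 * a else \<tau> * a)"
    and l2: "l2 = (if k = k_star a then - 3 / 2 else 1 / 2 + pi / (2 * k * R))"
  defines "z1 \<equiv> polar (1 / 2 * R) (angle m (2 * real j - 1))"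
    and "z2 \<equiv> polar (l2 * R) (angle m (2 * real j - 1))"
  obtains B1 B2 where "\<And>x. x \<in> Gamma_arc m R j \<Longrightarrow>
      0 < k * norm (x - z1) \<and> 0 < k * norm (x - z2) \<and>
      norm (hankel_H0 (k * norm (x - z1))) \<le> B1 \<and> norm (hankel_H0 (k * norm (x - z2))) \<le> B2 \<and>
      B1 * norm (hankel_H0 (k * norm (x - z2))) + B2 * norm (hankel_H0 (k * norm (x - z1)))
        \<le> 7 * \<bar>cross (k * norm (x - z1)) (k * norm (x - z2))\<bar> \<and>
      cross (k * norm (x - z1)) (k * norm (x - z2)) \<noteq> 0"
proof -
  have R0: "R > 0" using assms by auto
  \<comment> \<open>The half-opening of the arc is \<open>pi / m\<close>, at most
    \<open>pi / 10\<close>; this is where \<open>m \<ge> 10\<close> enters.\<close>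
  have c: "95 / 100 \<le> cos (\<theta> - angle m (2 * real j - 1))" if "\<theta> \<in> arc_angles m j" for \<theta>
  proof -
    let ?\<alpha> = "\<theta> - angle m (2 * real j - 1)"
    have "angle m (2 * real j - 2) = angle m (2 * real j - 1) - pi / real m"
      "angle m (2 * real j) = angle m (2 * real j - 1) + pi / real m"
      unfolding angle_def diff_divide_distrib[symmetric] add_divide_distrib[symmetric]
      by (simp_all add: algebra_simps)
    then have "\<bar>?\<alpha>\<bar> \<le> pi / real m"
      using that unfolding arc_angles_def atLeastAtMost_iff by linarith
    also have "\<dots> \<le> 315 / 1000"
      using \<open>m \<ge> 10\<close> frac_le[of "315 / 100" pi 10 "real m"] pi_approx by simp
    finally have "?\<alpha>\<^sup>2 \<le> (315 / 1000)\<^sup>2" using power_mono[of "\<bar>?\<alpha>\<bar>" "315 / 1000" 2] by simp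
    then show ?thesis using cos_ge_quadratic[of ?\<alpha>] by (simp add: power2_eq_square)
  qed
  have sq: "(k * norm (polar R \<theta> - polar (l * R) \<phi>))\<^sup>2
      = (k * R)\<^sup>2 * (1 + l\<^sup>2 - 2 * l * cos (\<theta> - \<phi>))" for \<theta> l \<phi>
    using R0 by (simp add: power_mult_distrib norm_polar_diff)
  show thesis
  proof (cases "k = k_star a")
    case True
    then have k0: "k > 0" and kR: "k * R = pi / 5" using R assms by (simp_all add: k_star_def)
    show thesis
    proof (rule that)
      fix x assume "x \<in> Gamma_arc m R j"
      then obtain \<theta> where \<theta>: "\<theta> \<in> arc_angles m j" and x: "x = polar R \<theta>"
        by (auto simp: Gamma_arc_def)
      show "0 < k * norm (x - z1) \<and> 0 < k * norm (x - z2) \<and>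
          norm (hankel_H0 (k * norm (x - z1))) \<le> 142 / 100 \<and> norm (hankel_H0 (k * norm (x - z2))) \<le> 71 / 100 \<and>
          142 / 100 * norm (hankel_H0 (k * norm (x - z2))) + 71 / 100 * norm (hankel_H0 (k * norm (x - z1)))
            \<le> 7 * \<bar>cross (k * norm (x - z1)) (k * norm (x - z2))\<bar> \<and>
          cross (k * norm (x - z1)) (k * norm (x - z2)) \<noteq> 0"
      proof (rule arc_estimate_near[OF c[OF \<theta>] cos_le_one])
        show "0 \<le> k * norm (x - z1)" "0 \<le> k * norm (x - z2)" using k0 by simp_all
        show "(k * norm (x - z1))\<^sup>2 = (pi / 5)\<^sup>2 * (1 + (1 / 2)\<^sup>2
            - 2 * (1 / 2) * cos (\<theta> - angle m (2 * real j - 1)))"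
          unfolding x z1_def sq kR ..
        have "l2 = - 3 / 2" using l2 True by simp
        then show "(k * norm (x - z2))\<^sup>2 = (pi / 5)\<^sup>2 * (1 + (- 3 / 2)\<^sup>2
            - 2 * (- 3 / 2) * cos (\<theta> - angle m (2 * real j - 1)))"
          unfolding x z2_def sq kR by simp
      qed
    qed
  next
    case False
    have "6 * pi \<le> \<tau> * pi" using assms by simp
    also have "\<dots> = pi / a * R" using assms False by simp
    also have "\<dots> \<le> k * R"
      using R0 wavenumber_ge[OF assms(4) False \<open>a > 0\<close>] by (intro mult_right_mono) auto
    finally have kR: "6 * pi \<le> k * R" .
    have "0 < pi / a" using \<open>a > 0\<close> by simp
    then have k0: "k > 0" using wavenumber_ge[OF assms(4) False \<open>a > 0\<close>] by linarith
    show thesis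
    proof (rule that)
      fix x assume "x \<in> Gamma_arc m R j"
      then obtain \<theta> where \<theta>: "\<theta> \<in> arc_angles m j" and x: "x = polar R \<theta>"
        by (auto simp: Gamma_arc_def)
      let ?B1 = "sqrt (3 / 2 / (k * R / 2))" and ?B2 = "sqrt (3 / 2 / (k * R / 2 - pi / 2))"
      show "0 < k * norm (x - z1) \<and> 0 < k * norm (x - z2) \<and>
          norm (hankel_H0 (k * norm (x - z1))) \<le> ?B1 \<and> norm (hankel_H0 (k * norm (x - z2))) \<le> ?B2 \<and>
          ?B1 * norm (hankel_H0 (k * norm (x - z2))) + ?B2 * norm (hankel_H0 (k * norm (x - z1)))
            \<le> 7 * \<bar>cross (k * norm (x - z1)) (k * norm (x - z2))\<bar> \<and>
          cross (k * norm (x - z1)) (k * norm (x - z2)) \<noteq> 0"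
      proof (rule arc_estimate_far[OF kR c[OF \<theta>] cos_le_one])
        show "0 \<le> k * norm (x - z1)" "0 \<le> k * norm (x - z2)" using k0 by simp_all
        show "(k * norm (x - z1))\<^sup>2 = (k * R)\<^sup>2 * (1 + (1 / 2)\<^sup>2
            - 2 * (1 / 2) * cos (\<theta> - angle m (2 * real j - 1)))"
          unfolding x z1_def sq ..
        have "l2 = 1 / 2 + pi / (2 * (k * R))" using l2 False by (simp add: mult.assoc)
        then show "(k * norm (x - z2))\<^sup>2 = (k * R)\<^sup>2 * (1 + (1 / 2 + pi / (2 * (k * R)))\<^sup>2
            - 2 * (1 / 2 + pi / (2 * (k * R))) * cos (\<theta> - angle m (2 * real j - 1)))"
          unfolding x z2_def sq by simp
      qed
    qed
  qed
qed

section \<open>The essential supremum on the arc\<close>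

text \<open>Non-measurable functions get the value \<open>\<infinity>\<close>, so finiteness alone
  yields measurability.\<close>

lemma arc_Linf_AE:
  assumes "arc_Linf m R j f \<noteq> \<infinity>"
  shows "(\<lambda>\<theta>. f (polar R \<theta>)) \<in> borel_measurable (lebesgue_on (arc_angles m j))"
    and "AE \<theta> in lebesgue_on (arc_angles m j). norm (f (polar R \<theta>)) \<le> enn2real (arc_Linf m R j f)"
proof -
  let ?M = "lebesgue_on (arc_angles m j)" and ?g = "\<lambda>\<theta>. ennreal (norm (f (polar R \<theta>)))"
  show meas: "(\<lambda>\<theta>. f (polar R \<theta>)) \<in> borel_measurable ?M"
    using assms by (auto simp: arc_Linf_def split: if_splits)
  then have eq: "arc_Linf m R j f = esssup ?M ?g" by (simp add: arc_Linf_def)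
  have "esssup ?M ?g = ennreal (enn2real (arc_Linf m R j f))"
    using assms by (subst eq[symmetric]) (simp add: less_top)
  moreover have "AE \<theta> in ?M. ?g \<theta> \<le> esssup ?M ?g" by (rule esssup_AE)
  ultimately show "AE \<theta> in ?M. norm (f (polar R \<theta>)) \<le> enn2real (arc_Linf m R j f)"
    by (simp only: ennreal_le_iff enn2real_nonneg)
qed

lemma arc_Linf_le:
  assumes [measurable]: "(\<lambda>\<theta>. f (polar R \<theta>)) \<in> borel_measurable (lebesgue_on (arc_angles m j))"
    and "AE \<theta> in lebesgue_on (arc_angles m j). norm (f (polar R \<theta>)) \<le> C"
  shows "arc_Linf m R j f \<le> ennreal C"
proof -
  have "AE \<theta> in lebesgue_on (arc_angles m j). ennreal (norm (f (polar R \<theta>))) \<le> ennreal C"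
    using assms(2) by (rule AE_mp) (auto intro: ennreal_leI)
  then show ?thesis by (auto simp: arc_Linf_def intro!: esssup_I)
qed

lemma arc_Linf_bounded:
  assumes "(\<lambda>\<theta>. f (polar R \<theta>)) \<in> borel_measurable (lebesgue_on (arc_angles m j))"
    and "AE \<theta> in lebesgue_on (arc_angles m j). norm (f (polar R \<theta>)) \<le> C" and "0 \<le> C"
  shows "arc_Linf m R j f \<noteq> \<infinity>" and "enn2real (arc_Linf m R j f) \<le> C"
proof -
  have le: "arc_Linf m R j f \<le> ennreal C" by (rule arc_Linf_le[OF assms(1,2)])
  then show "arc_Linf m R j f \<noteq> \<infinity>" by (auto simp: top_unique)
  show "enn2real (arc_Linf m R j f) \<le> C" by (rule enn2real_leI[OF assms(3) le])
qed

lemma continuous_on_polar: "continuous_on A (polar R)"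
proof -
  have "polar R = (\<lambda>\<theta>. (R * cos \<theta>) *\<^sub>R axis 1 1 + (R * sin \<theta>) *\<^sub>R axis 2 1)"
    by (auto simp: polar_def fun_eq_iff vec_eq_iff forall_2 axis_def)
  then show ?thesis by (auto intro!: continuous_intros)
qed

lemma arc_continuous_measurable:
  fixes g :: "real \<Rightarrow> 'a::{second_countable_topology, real_normed_vector}"
  shows "continuous_on (arc_angles m j) g \<Longrightarrow> g \<in> borel_measurable (lebesgue_on (arc_angles m j))"
  by (rule continuous_imp_measurable_on_sets_lebesgue) (simp_all add: arc_angles_def)

text \<open>A vanishing norm makes \<open>f\<close> zero almost everywhere, and for a continuous
  function on a nondegenerate interval a zero integral of the modulus upgrades this to everywhere.
  Later divisions by norms rely on it.\<close>

lemma arc_Linf_pos: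
  fixes f :: "real^2 \<Rightarrow> 'a::{second_countable_topology, real_normed_vector}"
  assumes "m > 0" and cont: "continuous_on (arc_angles m j) (\<lambda>\<theta>. f (polar R \<theta>))"
    and fin: "arc_Linf m R j f \<noteq> \<infinity>" and x: "x \<in> Gamma_arc m R j" "f x \<noteq> 0"
  shows "0 < enn2real (arc_Linf m R j f)"
proof (rule ccontr)
  assume "\<not> 0 < enn2real (arc_Linf m R j f)"
  then have zero: "norm y = 0" if "norm y \<le> enn2real (arc_Linf m R j f)" for y :: 'a
    using that norm_ge_zero[of y] by linarith
  have "AE \<theta> in lebesgue_on (arc_angles m j). norm (f (polar R \<theta>)) = 0"
    using arc_Linf_AE(2)[OF fin] by (rule eventually_mono) (rule zero)
  then have "integral\<^sup>L (lebesgue_on (arc_angles m j)) (\<lambda>\<theta>. norm (f (polar R \<theta>))) = 0"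
    by (rule integral_eq_zero_AE)
  moreover have "angle m (2 * real j - 2) < angle m (2 * real j)"
    using \<open>m > 0\<close> by (simp add: angle_def divide_strict_right_mono)
  ultimately have "\<forall>\<theta>\<in>arc_angles m j. norm (f (polar R \<theta>)) = 0"
    using integralL_eq_0_iff[OF continuous_on_norm[OF cont[unfolded arc_angles_def]]]
    unfolding arc_angles_def by simp
  then show False using x by (auto simp: Gamma_arc_def)
qed

lemma continuous_on_hankel_H0:
  assumes "continuous_on A g" "\<And>t. t \<in> A \<Longrightarrow> 0 < g t"
  shows "continuous_on A (\<lambda>t. hankel_H0 (g t))"
proof -
  have "continuous_on {0<..} bessel_J0" "continuous_on {0<..} bessel_Y0"
    by (rule continuous_at_imp_continuous_on;
        use DERIV_isCont[OF bessel_J0_deriv] DERIV_isCont[OF bessel_Y0_deriv] in simp)+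
  then have "continuous_on {0<..} hankel_H0"
    unfolding hankel_H0_def[abs_def] by (intro continuous_intros)
  then show ?thesis
    by (rule continuous_on_compose2) (use assms in auto)
qed

section \<open>Stability of the recovery\<close>

text \<open>Cramer's rule for both unknowns at once, packed into one complex equation.\<close>

lemma linear_system_solution:
  assumes "bessel_Y0 x1 * Re w - bessel_J0 x1 * Im w = f1"
    and "bessel_Y0 x2 * Re w - bessel_J0 x2 * Im w = f2"
  shows "complex_of_real (cross x1 x2) * w = of_real f1 * hankel_H0 x2 - of_real f2 * hankel_H0 x1"
  by (rule complex_eqI)
    (simp_all add: cross_def hankel_H0_def flip: assms, simp_all add: algebra_simps)

text \<open>When the square is expanded, the mixed term is linear in \<open>u\<close>. Exact moduli
  thus satisfy the system exactly for every nonzero \<open>c\<close>, so computing \<open>c\<close>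
  from noisy data introduces no error of its own.\<close>

lemma phaseless_identity:
  fixes u :: complex
  assumes "c \<noteq> 0"
  shows "2 / c * ((norm (u - complex_of_real c * (\<i> / 4 * hankel_H0 x)))\<^sup>2 - (norm u)\<^sup>2)
      - c / 8 * (norm (hankel_H0 x))\<^sup>2
    = bessel_Y0 x * Re u - bessel_J0 x * Im u"
proof -
  have "(norm (u - complex_of_real c * (\<i> / 4 * hankel_H0 x)))\<^sup>2
      = (Re u + c * bessel_Y0 x / 4)\<^sup>2 + (Im u - c * bessel_J0 x / 4)\<^sup>2"
    by (simp add: cmod_power2 hankel_H0_def)
  then show ?thesis
    unfolding norm_hankel_H0 cmod_power2[of u]
    using assms by (simp only:) (simp add: power2_eq_square field_simps)
qed

lemma abs_diff_squares_le:
  fixes s t V \<epsilon> :: real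
  assumes "0 \<le> s" "0 \<le> t" "t \<le> V" "\<bar>s - t\<bar> \<le> \<epsilon> * V"
  shows "\<bar>s\<^sup>2 - t\<^sup>2\<bar> \<le> \<epsilon> * (2 + \<epsilon>) * V\<^sup>2"
proof -
  have "\<bar>s\<^sup>2 - t\<^sup>2\<bar> = \<bar>s - t\<bar> * (s + t)"
    using assms by (simp add: square_diff_square_factored power2_eq_square abs_mult mult.commute)
  also have "\<dots> \<le> (\<epsilon> * V) * ((2 + \<epsilon>) * V)"
    using assms by (intro mult_mono) (auto simp: algebra_simps)
  finally show ?thesis by (simp add: power2_eq_square ac_simps)
qed

text \<open>
  Equality holds at \<open>\<epsilon> = 1\<close>: this is why the factor 7 suffices in the estimates on the arc.
\<close>
lemma error_constant:
  fixes \<epsilon> :: real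
  assumes "0 < \<epsilon>" "\<epsilon> < 1"
  shows "7 / 2 * ((2 + \<epsilon>) * ((2 + \<epsilon>)\<^sup>2 + 1)) \<le> 5 / 2 * (2 + \<epsilon>)\<^sup>2 * (3 + \<epsilon>) + 15"
proof -
  have "\<epsilon>\<^sup>2 \<le> 1" "\<epsilon> ^ 3 \<le> 1" using assms by (simp_all add: power_le_one)
  moreover have "5 / 2 * (2 + \<epsilon>)\<^sup>2 * (3 + \<epsilon>) + 15 - 7 / 2 * ((2 + \<epsilon>) * ((2 + \<epsilon>)\<^sup>2 + 1))
      = 10 - 11 / 2 * \<epsilon> - 7 / 2 * \<epsilon>\<^sup>2 - \<epsilon> ^ 3"
    by (simp add: power2_eq_square power3_eq_cube field_simps)
  ultimately show ?thesis using assms by linarith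
qed

text \<open>\<open>U\<close>, \<open>P\<close> and \<open>F l\<close> stand for the norms of the
  field, of \<open>p\<close> and of \<open>Phi\<close>. Subtracting the identity for exact data
  leaves a system for \<open>w - uu\<close> whose right-hand sides are the data errors
  \<open>e l\<close>; Cramer's rule and the arc estimate then finish.\<close>

lemma recovered_field_error:
  fixes w uu :: complex
  assumes eps: "0 < \<epsilon>" "\<epsilon> < 1" and U: "0 < U" and P: "(1 - \<epsilon>) * U \<le> P"
    and F: "\<And>l. l \<in> {1, 2} \<Longrightarrow> 0 < F l \<and> F l \<le> B l / 4"
    and c: "\<And>l. l \<in> {1, 2} \<Longrightarrow> c l = P / F l"
    and p: "0 \<le> p" "norm uu \<le> U" "\<bar>p - norm uu\<bar> \<le> \<epsilon> * U"
    and v: "\<And>l. l \<in> {1, 2} \<Longrightarrow> v l = uu - complex_of_real (c l) * (\<i> / 4 * hankel_H0 (x l))"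
    and q: "\<And>l. l \<in> {1, 2} \<Longrightarrow> 0 \<le> q l \<and> norm (v l) \<le> (2 + \<epsilon>) * U
        \<and> \<bar>q l - norm (v l)\<bar> \<le> \<epsilon> * ((2 + \<epsilon>) * U)"
    and w: "\<And>l. l \<in> {1, 2} \<Longrightarrow> bessel_Y0 (x l) * Re w - bessel_J0 (x l) * Im w
        = 2 / c l * ((q l)\<^sup>2 - p\<^sup>2) - c l / 8 * (norm (hankel_H0 (x l)))\<^sup>2"
    and est: "B 1 * norm (hankel_H0 (x 2)) + B 2 * norm (hankel_H0 (x 1)) \<le> 7 * \<bar>cross (x 1) (x (2::nat))\<bar>"
      "cross (x 1) (x 2) \<noteq> 0"
  shows "norm (w - uu) \<le> \<epsilon> * ((5 / 2 * (2 + \<epsilon>)\<^sup>2 * (3 + \<epsilon>) + 15) / (1 - \<epsilon>)) * U"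
proof -
  \<comment> \<open>\<open>?G\<close> collects the errors of the squared data:
    \<open>(2 + \<epsilon>) ^ 3\<close> from \<open>q\<close>, where moduli reach
    \<open>(2 + \<epsilon>) * U\<close>, and \<open>2 + \<epsilon>\<close> from
    \<open>p\<close>.\<close>
  let ?G = "(2 + \<epsilon>) * ((2 + \<epsilon>)\<^sup>2 + 1)"
  define K where "K = \<epsilon> * ?G * U / (1 - \<epsilon>) / 2"
  define e where "e = (\<lambda>l. 2 / c l * (((q l)\<^sup>2 - (norm (v l))\<^sup>2) - (p\<^sup>2 - (norm uu)\<^sup>2)))"
  have "0 < (1 - \<epsilon>) * U" using eps U by simp
  then have P0: "0 < P" using P by (rule less_le_trans)
  have K0: "0 \<le> K" using eps U by (simp add: K_def)
  have e_eq: "bessel_Y0 (x l) * Re (w - uu) - bessel_J0 (x l) * Im (w - uu) = e l" if l: "l \<in> {1, 2}" for l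
  proof -
    have "c l \<noteq> 0" using c[OF l] F[OF l] P0 by simp
    from phaseless_identity[OF this, of uu "x l", folded v[OF l]] w[OF l]
    show ?thesis by (simp add: e_def algebra_simps)
  qed
  have e_le: "\<bar>e l\<bar> \<le> B l * K" if l: "l \<in> {1, 2}" for l
  proof -
    have "\<bar>((q l)\<^sup>2 - (norm (v l))\<^sup>2) - (p\<^sup>2 - (norm uu)\<^sup>2)\<bar>
        \<le> \<epsilon> * (2 + \<epsilon>) * ((2 + \<epsilon>) * U)\<^sup>2 + \<epsilon> * (2 + \<epsilon>) * U\<^sup>2"
      using abs_diff_squares_le[of "q l" "norm (v l)" "(2 + \<epsilon>) * U" \<epsilon>]
        abs_diff_squares_le[of p "norm uu" U \<epsilon>] q[OF l] p by simp
    also have "\<dots> = \<epsilon> * ?G * U\<^sup>2" by (simp add: power2_eq_square algebra_simps)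
    finally have diff: "\<bar>((q l)\<^sup>2 - (norm (v l))\<^sup>2) - (p\<^sup>2 - (norm uu)\<^sup>2)\<bar> \<le> \<epsilon> * ?G * U\<^sup>2" .
    \<comment> \<open>The amplitude \<open>c l\<close> is bounded below through \<open>P\<close> and
      through \<open>F l \<le> B l / 4\<close>, whose 4 is that of \<open>\<i> / 4\<close> in
      \<open>Phi\<close>.\<close>
    have "2 / c l = 2 * F l / P" using c[OF l] by simp
    also have "\<dots> \<le> (B l / 2) / ((1 - \<epsilon>) * U)"
      using F[OF l] P eps U by (intro frac_le) auto
    finally have cinv: "2 / c l \<le> (B l / 2) / ((1 - \<epsilon>) * U)" .
    have c0: "0 < 2 / c l" using c[OF l] F[OF l] P0 by simp
    have "\<bar>e l\<bar> = 2 / c l * \<bar>((q l)\<^sup>2 - (norm (v l))\<^sup>2) - (p\<^sup>2 - (norm uu)\<^sup>2)\<bar>"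
      unfolding e_def abs_mult using c0 by simp
    also have "\<dots> \<le> (B l / 2) / ((1 - \<epsilon>) * U) * (\<epsilon> * ?G * U\<^sup>2)"
      using cinv diff c0 F[OF l] eps U by (intro mult_mono) auto
    also have "\<dots> = B l * K"
      using U by (simp add: K_def power2_eq_square) (simp add: ac_simps)
    finally show ?thesis .
  qed
  let ?D = "cross (x 1) (x 2)"
  have "\<bar>?D\<bar> * norm (w - uu) = norm (of_real (e 1) * hankel_H0 (x 2) - of_real (e 2) * hankel_H0 (x 1))"
  proof -
    have "complex_of_real ?D * (w - uu) = of_real (e 1) * hankel_H0 (x 2) - of_real (e 2) * hankel_H0 (x 1)"
      by (rule linear_system_solution) (rule e_eq, simp)+
    from arg_cong[OF this, of norm] show ?thesis by (simp only: norm_mult norm_of_real)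
  qed
  also have "\<dots> \<le> \<bar>e 1\<bar> * norm (hankel_H0 (x 2)) + \<bar>e 2\<bar> * norm (hankel_H0 (x 1))"
    by (rule order_trans[OF norm_triangle_ineq4]) (simp add: norm_mult)
  also have "\<dots> \<le> (B 1 * K) * norm (hankel_H0 (x 2)) + (B 2 * K) * norm (hankel_H0 (x 1))"
    by (intro add_mono mult_right_mono e_le) auto
  also have "\<dots> = K * (B 1 * norm (hankel_H0 (x 2)) + B 2 * norm (hankel_H0 (x 1)))"
    by (simp add: algebra_simps)
  also have "\<dots> \<le> K * (7 * \<bar>?D\<bar>)" using est(1) K0 by (rule mult_left_mono)
  finally have "norm (w - uu) * \<bar>?D\<bar> \<le> (7 * K) * \<bar>?D\<bar>" by (simp add: ac_simps)
  then have "norm (w - uu) \<le> 7 * K" using est(2) by simp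
  also have "\<dots> = \<epsilon> * ((7 / 2 * ?G) / (1 - \<epsilon>)) * U"
    by (simp add: K_def) (simp add: ac_simps)
  also have "\<dots> \<le> \<epsilon> * ((5 / 2 * (2 + \<epsilon>)\<^sup>2 * (3 + \<epsilon>) + 15) / (1 - \<epsilon>)) * U"
    using eps U by (intro mult_right_mono mult_left_mono divide_right_mono error_constant) auto
  finally show ?thesis .
qed

theorem theorem3p2:
  fixes a \<tau> k R \<epsilon> :: real
    and N m j :: nat
    and lam c :: "nat \<Rightarrow> real"
    and z :: "nat \<Rightarrow> real^2"
    and S u u_eps :: "real^2 \<Rightarrow> complex"
    and p :: "real^2 \<Rightarrow> real"
    and q f :: "nat \<Rightarrow> real^2 \<Rightarrow> real"
    and v :: "nat \<Rightarrow> real^2 \<Rightarrow> complex"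
  assumes "a > 0" and "N \<ge> 1" and "m \<ge> 10" and "\<tau> \<ge> 6"
    and "k \<in> wavenumbers a N" and "j \<in> {1..m}"
    and "R = (if k = k_star a then 6 * a else \<tau> * a)"
    and "lam 1 = 1 / 2"
    and "lam 2 = (if k = k_star a then - 3 / 2 else 1 / 2 + pi / (2 * k * R))"
    and "\<And>l. l \<in> {1, 2} \<Longrightarrow> z l = polar (lam l * R) (angle m (2 * real j - 1))"
    and "square_integrable S" and "supp_compactly_in S (open_square a)"
    and "radiated_field k S u"
    and "\<exists>x\<in>Gamma_arc m R j. u x \<noteq> 0"
    and "0 < \<epsilon>" and "\<epsilon> < 1"
    and "\<And>x. x \<in> Gamma_arc m R j \<Longrightarrow> p x \<ge> 0"
    and "\<And>l x. l \<in> {1, 2} \<Longrightarrow> x \<in> Gamma_arc m R j \<Longrightarrow> q l x \<ge> 0"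
    and "\<And>l. l \<in> {1, 2} \<Longrightarrow>
           c l = enn2real (arc_Linf m R j p) / enn2real (arc_Linf m R j (\<lambda>x. Phi k x (z l)))"
    and "\<And>l x. l \<in> {1, 2} \<Longrightarrow> x \<in> Gamma_arc m R j \<Longrightarrow>
           v l x = u x - complex_of_real (c l) * Phi k x (z l)"
    and "arc_Linf m R j (\<lambda>x. p x - norm (u x)) \<le> ennreal \<epsilon> * arc_Linf m R j u"
    and "\<And>l. l \<in> {1, 2} \<Longrightarrow>
           arc_Linf m R j (\<lambda>x. q l x - norm (v l x)) \<le> ennreal \<epsilon> * arc_Linf m R j (v l)"
    and "\<And>l x. l \<in> {1, 2} \<Longrightarrow> x \<in> Gamma_arc m R j \<Longrightarrow>
           f l x = 2 / c l * ((q l x)\<^sup>2 - (p x)\<^sup>2)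
                   - c l / 8 * (norm (hankel_H0 (k * norm (x - z l))))\<^sup>2"
    and "\<And>l x. l \<in> {1, 2} \<Longrightarrow> x \<in> Gamma_arc m R j \<Longrightarrow>
           bessel_Y0 (k * norm (x - z l)) * Re (u_eps x)
             - bessel_J0 (k * norm (x - z l)) * Im (u_eps x) = f l x"
  shows "arc_Linf m R j (\<lambda>x. u_eps x - u x)
           \<le> ennreal (\<epsilon> * ((5 / 2 * (2 + \<epsilon>)\<^sup>2 * (3 + \<epsilon>) + 15) / (1 - \<epsilon>))) * arc_Linf m R j u"
proof -
  let ?M = "lebesgue_on (arc_angles m j)" and ?P = "polar R"
  have z: "z 1 = polar (1 / 2 * R) (angle m (2 * real j - 1))"
    "z 2 = polar (lam 2 * R) (angle m (2 * real j - 1))"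
    by (rule assms(10)[of 1, unfolded assms(8)] assms(10)[of 2], simp)+
  define r where "r = (\<lambda>l x. k * norm (x - z l))"
  obtain B1 B2 where est0: "\<And>x. x \<in> Gamma_arc m R j \<Longrightarrow>
      0 < r 1 x \<and> 0 < r 2 x \<and> norm (hankel_H0 (r 1 x)) \<le> B1 \<and> norm (hankel_H0 (r 2 x)) \<le> B2 \<and>
      B1 * norm (hankel_H0 (r 2 x)) + B2 * norm (hankel_H0 (r 1 x)) \<le> 7 * \<bar>cross (r 1 x) (r 2 x)\<bar> \<and>
      cross (r 1 x) (r 2 x) \<noteq> 0"
    unfolding r_def z
    by (rule arc_estimate[where j = j, OF assms(1,3,4,5,7,9)]) blast
  define B where "B = (\<lambda>l::nat. if l = 1 then B1 else B2)"
  have est: "B 1 * norm (hankel_H0 (r 2 x)) + B 2 * norm (hankel_H0 (r 1 x)) \<le> 7 * \<bar>cross (r 1 x) (r 2 x)\<bar>"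
    "cross (r 1 x) (r 2 x) \<noteq> 0" if "x \<in> Gamma_arc m R j" for x
    using est0[OF that] by (simp_all add: B_def)
  have r_pos: "0 < r l x" and H_le: "norm (hankel_H0 (r l x)) \<le> B l"
    if "l \<in> {1, 2}" "x \<in> Gamma_arc m R j" for l x
    using est0[OF that(2)] that(1) by (auto simp: B_def)
  \<comment> \<open>A zero of either Hankel function would make the cross product vanish; this makes
    the norms of \<open>Phi\<close> positive.\<close>
  have H_nz: "hankel_H0 (r l x) \<noteq> 0" if "l \<in> {1, 2}" "x \<in> Gamma_arc m R j" for l x
    using abs_cross_le[of "r 1 x" "r 2 x"] est(2)[OF that(2)] that(1) by auto
  have arc: "?P \<theta> \<in> Gamma_arc m R j" if "\<theta> \<in> arc_angles m j" for \<theta>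
    using that by (simp add: Gamma_arc_def)
  have on_arc: "AE \<theta> in ?M. ?P \<theta> \<in> Gamma_arc m R j"
    by (rule AE_I2) (simp add: arc)
  have cont_u: "continuous_on (arc_angles m j) (\<lambda>\<theta>. u (?P \<theta>))"
    using assms(13) unfolding radiated_field_def
    by (intro continuous_on_compose2[OF _ continuous_on_polar]) auto
  have cont_H: "continuous_on (arc_angles m j) (\<lambda>\<theta>. hankel_H0 (r l (?P \<theta>)))" if "l \<in> {1, 2}" for l
    using r_pos[OF that arc] unfolding r_def
    by (intro continuous_on_hankel_H0 continuous_intros continuous_on_polar) auto
  have Phi_eq: "Phi k x (z l) = \<i> / 4 * hankel_H0 (r l x)" for l x
    by (simp add: Phi_def r_def)
  have cont_Phi: "continuous_on (arc_angles m j) (\<lambda>\<theta>. Phi k (?P \<theta>) (z l))" if "l \<in> {1, 2}" for l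
    unfolding Phi_eq by (intro continuous_intros cont_H that)
  note meas_u = arc_continuous_measurable[OF cont_u]
    and meas_H = arc_continuous_measurable[OF cont_H]
    and meas_Phi = arc_continuous_measurable[OF cont_Phi]
  have m0: "m > 0" using assms(3) by simp

  define U where "U = enn2real (arc_Linf m R j u)"
  \<comment> \<open>The norm of \<open>u\<close> is finite because \<open>u\<close> is continuous on
    a compact arc.\<close>
  have "compact ((\<lambda>\<theta>. u (?P \<theta>)) ` arc_angles m j)"
    using cont_u by (rule compact_continuous_image) (simp add: arc_angles_def)
  then obtain K where "\<And>\<theta>. \<theta> \<in> arc_angles m j \<Longrightarrow> norm (u (?P \<theta>)) \<le> K"
    using compact_imp_bounded bounded_iff by (metis imageI)
  then have "AE \<theta> in ?M. norm (u (?P \<theta>)) \<le> max K 0"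
    by (intro AE_I2) (auto intro: le_max_iff_disj[THEN iffD2])
  then have u_fin: "arc_Linf m R j u \<noteq> \<infinity>"
    by (rule arc_Linf_bounded(1)[OF meas_u]) simp
  then have u_U: "arc_Linf m R j u = ennreal U" by (simp add: U_def less_top)
  have U0: "0 < U"
    unfolding U_def using assms(14) arc_Linf_pos[OF m0 cont_u u_fin] by blast
  have u_le: "AE \<theta> in ?M. norm (u (?P \<theta>)) \<le> U"
    unfolding U_def by (rule arc_Linf_AE(2)[OF u_fin])

  \<comment> \<open>The right-hand side of a noise bound is finite, so the bound also provides
    measurability of the data error.\<close>
  have noise: "(\<lambda>\<theta>. g (?P \<theta>)) \<in> borel_measurable ?M \<and> (AE \<theta> in ?M. \<bar>g (?P \<theta>)\<bar> \<le> \<epsilon> * V)"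
    if "arc_Linf m R j g \<le> ennreal \<epsilon> * arc_Linf m R j h" "arc_Linf m R j h \<le> ennreal V" "0 \<le> V"
    for g :: "real^2 \<Rightarrow> real" and h :: "real^2 \<Rightarrow> complex" and V
  proof -
    have "arc_Linf m R j g \<le> ennreal \<epsilon> * ennreal V"
      using that(1) mult_left_mono[OF that(2), of "ennreal \<epsilon>"] by (rule order_trans) simp
    also have "\<dots> = ennreal (\<epsilon> * V)"
      using assms(15) that(3) by (simp add: ennreal_mult)
    finally have le: "arc_Linf m R j g \<le> ennreal (\<epsilon> * V)" .
    then have fin: "arc_Linf m R j g \<noteq> \<infinity>" by (auto simp: top_unique)
    have "enn2real (arc_Linf m R j g) \<le> \<epsilon> * V"
      using assms(15) that(3) le by (intro enn2real_leI) auto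
    with arc_Linf_AE[OF fin] show ?thesis
      by (auto elim!: eventually_mono)
  qed
  have p_noise: "(\<lambda>\<theta>. p (?P \<theta>) - norm (u (?P \<theta>))) \<in> borel_measurable ?M"
      "AE \<theta> in ?M. \<bar>p (?P \<theta>) - norm (u (?P \<theta>))\<bar> \<le> \<epsilon> * U"
    using noise[OF assms(21)] u_U U0 by auto
  \<comment> \<open>Measurability of \<open>p\<close> itself is recovered by adding
    \<open>norm u\<close> back to the measurable difference.\<close>
  have "(\<lambda>\<theta>. (p (?P \<theta>) - norm (u (?P \<theta>))) + norm (u (?P \<theta>))) \<in> borel_measurable ?M"
    using p_noise(1) meas_u by measurable
  then have meas_p: "(\<lambda>\<theta>. p (?P \<theta>)) \<in> borel_measurable ?M" by simp
  define Pn where "Pn = enn2real (arc_Linf m R j p)"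
  have "AE \<theta> in ?M. norm (p (?P \<theta>)) \<le> (1 + \<epsilon>) * U"
    using p_noise(2) u_le on_arc
  proof eventually_elim
    case (elim \<theta>)
    then show ?case using assms(17)[of "?P \<theta>"] by (simp add: algebra_simps)
  qed
  from arc_Linf_bounded[OF meas_p this] have p_fin: "arc_Linf m R j p \<noteq> \<infinity>"
    and Pn_le: "Pn \<le> (1 + \<epsilon>) * U"
    using U0 assms(15) by (simp_all add: Pn_def)
  have Pn_nonneg: "0 \<le> Pn" by (simp add: Pn_def)
  \<comment> \<open>The reverse comparison: \<open>U \<le> Pn + \<epsilon> * U\<close> bounds
    \<open>Pn\<close> from below and produces the denominator \<open>1 - \<epsilon>\<close>.\<close>
  have "AE \<theta> in ?M. norm (u (?P \<theta>)) \<le> Pn + \<epsilon> * U"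
    using p_noise(2) arc_Linf_AE(2)[OF p_fin]
  proof eventually_elim
    case (elim \<theta>)
    then show ?case unfolding Pn_def real_norm_def by linarith
  qed
  from arc_Linf_bounded(2)[OF meas_u this] have Pn_ge: "(1 - \<epsilon>) * U \<le> Pn"
    using Pn_nonneg U0 assms(15) by (simp add: U_def[symmetric] algebra_simps)

  define F where "F = (\<lambda>l. enn2real (arc_Linf m R j (\<lambda>x. Phi k x (z l))))"
  have F: "0 < F l \<and> F l \<le> B l / 4" and Phi_le: "AE \<theta> in ?M. norm (Phi k (?P \<theta>) (z l)) \<le> F l"
    if l: "l \<in> {1, 2}" for l
  proof -
    obtain x where x: "x \<in> Gamma_arc m R j" using assms(14) by blast
    have B0: "0 \<le> B l / 4" using H_le[OF l x] norm_ge_zero[of "hankel_H0 (r l x)"] by linarith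
    have "AE \<theta> in ?M. norm (Phi k (?P \<theta>) (z l)) \<le> B l / 4"
      using on_arc by (rule eventually_mono) (simp add: Phi_eq norm_mult norm_divide H_le[OF l])
    note bnd = arc_Linf_bounded[where f = "\<lambda>x. Phi k x (z l)", OF meas_Phi[OF l] this B0]
    show "AE \<theta> in ?M. norm (Phi k (?P \<theta>) (z l)) \<le> F l"
      unfolding F_def by (rule arc_Linf_AE(2)[OF bnd(1)])
    have "0 < F l"
      unfolding F_def
      by (rule arc_Linf_pos[where f = "\<lambda>x. Phi k x (z l)", OF m0 cont_Phi[OF l] bnd(1) x])
        (simp add: Phi_eq H_nz[OF l x])
    then show "0 < F l \<and> F l \<le> B l / 4" using bnd(2) by (simp add: F_def)
  qed
  have c: "c l = Pn / F l" if "l \<in> {1, 2}" for l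
    using assms(19)[OF that] by (simp add: Pn_def F_def)

  have meas_v: "(\<lambda>\<theta>. v l (?P \<theta>)) \<in> borel_measurable ?M"
    and v_le: "AE \<theta> in ?M. norm (v l (?P \<theta>)) \<le> (2 + \<epsilon>) * U" if l: "l \<in> {1, 2}" for l
  proof -
    have "(\<lambda>\<theta>. u (?P \<theta>) - complex_of_real (c l) * Phi k (?P \<theta>) (z l)) \<in> borel_measurable ?M"
      using meas_u meas_Phi[OF l] by measurable
    then show "(\<lambda>\<theta>. v l (?P \<theta>)) \<in> borel_measurable ?M"
      by (rule measurable_cong[THEN iffD1, rotated]) (simp add: assms(20)[OF l arc])
    have "0 \<le> c l" using c[OF l] F[OF l] Pn_nonneg by simp
    \<comment> \<open>The amplitude is scaled so that the reference field has norm
      \<open>Pn\<close>, at most \<open>(1 + \<epsilon>) * U\<close>; adding \<open>u\<close> gives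
      \<open>2 + \<epsilon>\<close>.\<close>
    have cF: "c l * F l = Pn" using c[OF l] F[OF l] by simp
    show "AE \<theta> in ?M. norm (v l (?P \<theta>)) \<le> (2 + \<epsilon>) * U"
      using on_arc u_le Phi_le[OF l]
    proof eventually_elim
      case (elim \<theta>)
      have "norm (v l (?P \<theta>)) \<le> norm (u (?P \<theta>)) + norm (complex_of_real (c l) * Phi k (?P \<theta>) (z l))"
        unfolding assms(20)[OF l elim(1)] by (rule norm_triangle_ineq4)
      also have "norm (complex_of_real (c l) * Phi k (?P \<theta>) (z l)) \<le> c l * F l"
        unfolding norm_mult norm_of_real using \<open>0 \<le> c l\<close> elim(3) by (simp add: mult_left_mono)
      finally show ?case using elim(2) Pn_le unfolding cF by (simp add: algebra_simps)
    qed
  qed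
  have V0: "0 \<le> (2 + \<epsilon>) * U" using U0 assms(15) by simp
  have q_noise: "(\<lambda>\<theta>. q l (?P \<theta>) - norm (v l (?P \<theta>))) \<in> borel_measurable ?M"
      "AE \<theta> in ?M. \<bar>q l (?P \<theta>) - norm (v l (?P \<theta>))\<bar> \<le> \<epsilon> * ((2 + \<epsilon>) * U)" if l: "l \<in> {1, 2}" for l
    using noise[OF assms(22)[OF l] arc_Linf_le[OF meas_v[OF l] v_le[OF l]] V0] by auto
  have meas_q: "(\<lambda>\<theta>. q l (?P \<theta>)) \<in> borel_measurable ?M" if l: "l \<in> {1, 2}" for l
  proof -
    have "(\<lambda>\<theta>. (q l (?P \<theta>) - norm (v l (?P \<theta>))) + norm (v l (?P \<theta>))) \<in> borel_measurable ?M"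
      using q_noise(1)[OF l] meas_v[OF l] by measurable
    then show ?thesis by simp
  qed
  have meas_f: "(\<lambda>\<theta>. f l (?P \<theta>)) \<in> borel_measurable ?M" if l: "l \<in> {1, 2}" for l
  proof -
    have "(\<lambda>\<theta>. 2 / c l * ((q l (?P \<theta>))\<^sup>2 - (p (?P \<theta>))\<^sup>2)
        - c l / 8 * (norm (hankel_H0 (r l (?P \<theta>))))\<^sup>2) \<in> borel_measurable ?M"
      using meas_q[OF l] meas_p meas_H[OF l] by measurable
    then show ?thesis
      by (rule measurable_cong[THEN iffD1, rotated]) (simp add: assms(23)[OF l arc] r_def)
  qed
  have system: "bessel_Y0 (r l x) * Re (u_eps x) - bessel_J0 (r l x) * Im (u_eps x) = f l x"
    if "l \<in> {1, 2}" "x \<in> Gamma_arc m R j" for l x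
    using assms(24)[OF that] by (simp add: r_def)
  \<comment> \<open>Without measurability the norm of the error would be \<open>\<infinity>\<close>.
    Cramer's formula, whose denominator never vanishes on the arc, expresses \<open>u_eps\<close>
    through measurable functions.\<close>
  have meas_u_eps: "(\<lambda>\<theta>. u_eps (?P \<theta>)) \<in> borel_measurable ?M"
  proof -
    let ?H = "\<lambda>l \<theta>. hankel_H0 (r l (?P \<theta>))"
    have "cross x y = Im (hankel_H0 x * cnj (hankel_H0 y))" for x y
      by (simp add: cross_def hankel_H0_def)
    then have "(\<lambda>\<theta>. cross (r 1 (?P \<theta>)) (r 2 (?P \<theta>))) \<in> borel_measurable ?M"
      using cont_H[of 1] cont_H[of 2]
      by (simp only:) (intro arc_continuous_measurable continuous_intros; simp)
    then have "(\<lambda>\<theta>. (complex_of_real (f 1 (?P \<theta>)) * ?H 2 \<theta> - complex_of_real (f 2 (?P \<theta>)) * ?H 1 \<theta>)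
        / complex_of_real (cross (r 1 (?P \<theta>)) (r 2 (?P \<theta>)))) \<in> borel_measurable ?M"
      using meas_f[of 1] meas_f[of 2] meas_H[of 1] meas_H[of 2]
      by (intro borel_measurable_divide borel_measurable_diff borel_measurable_times
          borel_measurable_of_real) auto
    then show ?thesis
    proof (rule measurable_cong[THEN iffD1, rotated])
      fix \<theta> assume "\<theta> \<in> space ?M"
      then have x: "?P \<theta> \<in> Gamma_arc m R j" by (simp add: arc)
      show "(complex_of_real (f 1 (?P \<theta>)) * ?H 2 \<theta> - complex_of_real (f 2 (?P \<theta>)) * ?H 1 \<theta>)
          / complex_of_real (cross (r 1 (?P \<theta>)) (r 2 (?P \<theta>))) = u_eps (?P \<theta>)"
        using linear_system_solution[OF system[OF _ x] system[OF _ x], of 1 2] est(2)[OF x]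
        by (simp add: divide_eq_eq mult.commute)
    qed
  qed

  have "AE \<theta> in ?M. norm (u_eps (?P \<theta>) - u (?P \<theta>))
      \<le> \<epsilon> * ((5 / 2 * (2 + \<epsilon>)\<^sup>2 * (3 + \<epsilon>) + 15) / (1 - \<epsilon>)) * U"
    using on_arc u_le p_noise(2) v_le[of 1, simplified] v_le[of 2, simplified]
      q_noise(2)[of 1, simplified] q_noise(2)[of 2, simplified]
  proof eventually_elim
    case (elim \<theta>)
    let ?x = "?P \<theta>"
    show ?case
    proof (rule recovered_field_error[where F = F and B = B and c = c and P = Pn and p = "p ?x"
          and v = "\<lambda>l. v l ?x" and q = "\<lambda>l. q l ?x" and x = "\<lambda>l. r l ?x"])
      show "0 \<le> p ?x" "norm (u ?x) \<le> U" "\<bar>p ?x - norm (u ?x)\<bar> \<le> \<epsilon> * U"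
        using assms(17) elim by auto
    next
      fix l :: nat assume l: "l \<in> {1, 2}"
      show "v l ?x = u ?x - complex_of_real (c l) * (\<i> / 4 * hankel_H0 (r l ?x))"
        using assms(20)[OF l elim(1)] by (simp only: Phi_eq)
      show "0 \<le> q l ?x \<and> norm (v l ?x) \<le> (2 + \<epsilon>) * U
          \<and> \<bar>q l ?x - norm (v l ?x)\<bar> \<le> \<epsilon> * ((2 + \<epsilon>) * U)"
        using assms(18)[OF l elim(1)] elim l by auto
      show "bessel_Y0 (r l ?x) * Re (u_eps ?x) - bessel_J0 (r l ?x) * Im (u_eps ?x)
          = 2 / c l * ((q l ?x)\<^sup>2 - (p ?x)\<^sup>2) - c l / 8 * (norm (hankel_H0 (r l ?x)))\<^sup>2"
        using system[OF l elim(1)] assms(23)[OF l elim(1)] by (simp add: r_def)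
    qed (use assms(15,16) U0 Pn_ge F c est[OF elim(1)] in auto)
  qed
  then have "arc_Linf m R j (\<lambda>x. u_eps x - u x)
      \<le> ennreal (\<epsilon> * ((5 / 2 * (2 + \<epsilon>)\<^sup>2 * (3 + \<epsilon>) + 15) / (1 - \<epsilon>)) * U)"
    by (intro arc_Linf_le borel_measurable_diff meas_u_eps meas_u)
  also have "\<dots> = ennreal (\<epsilon> * ((5 / 2 * (2 + \<epsilon>)\<^sup>2 * (3 + \<epsilon>) + 15) / (1 - \<epsilon>))) * arc_Linf m R j u"
    unfolding u_U using assms(15,16) U0 by (intro ennreal_mult) auto
  finally show ?thesis .
qed

end
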